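(* Let $\rho>0$ and let $Q:\mathbb{R}\to\mathbb{R}$ be a function such that $x\mapsto Q(x)-\rho x^{2}$ is convex on $\mathbb{R}$. Then for every $n\ge2$, every $\nu\in\mathcal{P}(\mathbb{R})$ and every Fekete point $\mathbf{y}\in\mathbb{R}^{n}$ for $E^{Q}_{n}$, $$\rho\,\bigl(W_{2}(\nu,\mu(\mathbf{y}))\bigr)^{2}\le E^{Q}(\nu)-\Delta^{Q}_{n}.$$ Furthermore, if $\mu_{Q}$ is the minimizing measure of $E^{Q}$ on $\mathcal{P}(\mathbb{R})$ and, for each $n\ge 2$, $\mathbf{y}_{n}\in\mathbb{R}^{n}$ is a Fekete point for $E^{Q}_{n}$, then $$\lim_{n\to\infty}\Delta^{Q}_{n}=I^{Q}\qquad\text{and}\qquad\lim_{n\to\infty}W_{2}(\mu_{Q},\mu(\mathbf{y}_{n}))=0,$$ hence $\mu(\mathbf{y}_{n})\to\mu_{Q}$ weakly as $n\to\infty$.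
   Context: $\mathcal{P}(\mathbb{R})$ is the set of Borel probability measures on $\mathbb{R}$. For $\mu\in\mathcal{P}(\mathbb{R})$, $E^{Q}(\mu)=\int Q(x)\,\mu(dx)-\iint\log|x-y|\,\mu(dx)\,\mu(dy)\in(-\infty,+\infty]$, understood as $\iint[\frac12(Q(x)+Q(y))-\log|x-y|]\,\mu(dx)\mu(dy)$ (the integrand is bounded below, with $-\log 0=+\infty$); $I^{Q}=\inf_{\mu\in\mathcal{P}(\mathbb{R})}E^{Q}(\mu)$, and under the stated assumption on $Q$ this infimum is attained at a unique measure $\mu_{Q}$. For $n\ge2$ and $\mathbf{x}=(x_{1},\dots,x_{n})\in\mathbb{R}^{n}$, $E^{Q}_{n}(\mathbf{x})=\frac1n\sum_{i=1}^{n}Q(x_{i})-\frac{2}{n(n-1)}\sum_{1\le i<j\le n}\log|x_{i}-x_{j}|$, $\Delta^{Q}_{n}=\inf_{\mathbf{x}\in\mathbb{R}^{n}}E^{Q}_{n}(\mathbf{x})$, and $\mu(\mathbf{x})=\frac1n\sum_{k=1}^{n}\delta_{x_{k}}$. A Fekete point for $E^{Q}_{n}$ is a minimum point of $E^{Q}_{n}$, i.e. $\mathbf{y}\in\mathbb{R}^{n}$ with $E^{Q}_{n}(\mathbf{y})=\Delta^{Q}_{n}$. $W_{2}(\mu,\nu)=\sqrt{\inf_{\pi\in\Pi(\mu,\nu)}\iint|x-y|^{2}\,d\pi(x,y)}$, where $\Pi(\mu,\nu)$ is the set of probability measures on $\mathbb{R}^{2}$ with marginals $\mu$ and $\nu$.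 The first inequality is trivially true when $E^{Q}(\nu)=+\infty$. *)

theory Defs
  imports "HOL-Probability.Probability"
begin

definition ext_log :: "real \<Rightarrow> ereal" where
  "ext_log t = (if t = 0 then -\<infinity> else ereal (ln t))"

text \<open>
  Lebesgue integral of an extended-real integrand, as the integral of the positive part minus that
  of the negative part (the conversion to non-negative extended reals truncates at 0).  It is only
  meaningful if the negative part has finite integral.
\<close>

definition ereal_integral :: "'a measure \<Rightarrow> ('a \<Rightarrow> ereal) \<Rightarrow> ereal" where
  "ereal_integral M f =
     enn2ereal (\<integral>\<^sup>+ x. e2ennreal (f x) \<partial>M) - enn2ereal (\<integral>\<^sup>+ x. e2ennreal (- f x) \<partial>M)"

text \<open>
  If \<open>Q\<close> exceeds a convex function by a positive multiple of \<open>x\<^sup>2\<close>, the integrand in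
  \<open>energy\<close> is measurable and bounded below, so the integral over a probability measure is a
  well-defined element of \<open>(-\<infinity>, \<infinity>]\<close>.
\<close>

definition energy :: "(real \<Rightarrow> real) \<Rightarrow> real measure \<Rightarrow> ereal" where
  "energy Q \<mu> =
     ereal_integral (\<mu> \<Otimes>\<^sub>M \<mu>) (\<lambda>(x, y). ereal ((Q x + Q y) / 2) - ext_log \<bar>x - y\<bar>)"

definition min_energy :: "(real \<Rightarrow> real) \<Rightarrow> ereal" where
  "min_energy Q = (INF \<mu>\<in>{\<mu>. real_distribution \<mu>}. energy Q \<mu>)"

definition minimizing_measure :: "(real \<Rightarrow> real) \<Rightarrow> real measure \<Rightarrow> bool" where
  "minimizing_measure Q \<mu> \<longleftrightarrow> real_distribution \<mu> \<and> energy Q \<mu> = min_energy Q"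

text \<open>Vectors of length \<open>n\<close> are the extensional functions on \<open>{1..n}\<close>.\<close>

definition vecs :: "nat \<Rightarrow> (nat \<Rightarrow> real) set" where
  "vecs n = {1..n} \<rightarrow>\<^sub>E UNIV"

definition discrete_energy :: "(real \<Rightarrow> real) \<Rightarrow> nat \<Rightarrow> (nat \<Rightarrow> real) \<Rightarrow> ereal" where
  "discrete_energy Q n x =
     ereal (1 / real n * (\<Sum>i = 1..n. Q (x i)))
     - ereal (2 / (real n * (real n - 1)))
       * (\<Sum>(i, j) \<in> {(i, j). 1 \<le> i \<and> i < j \<and> j \<le> n}. ext_log \<bar>x i - x j\<bar>)"

definition min_discrete_energy :: "(real \<Rightarrow> real) \<Rightarrow> nat \<Rightarrow> ereal" where
  "min_discrete_energy Q n = (INF x\<in>vecs n. discrete_energy Q n x)"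

definition fekete_point :: "(real \<Rightarrow> real) \<Rightarrow> nat \<Rightarrow> (nat \<Rightarrow> real) \<Rightarrow> bool" where
  "fekete_point Q n y \<longleftrightarrow> y \<in> vecs n \<and> discrete_energy Q n y = min_discrete_energy Q n"

definition empirical_measure :: "nat \<Rightarrow> (nat \<Rightarrow> real) \<Rightarrow> real measure" where
  "empirical_measure n x =
     measure_of UNIV (sets borel) (\<lambda>A. (\<Sum>k = 1..n. emeasure (return borel (x k)) A) / of_nat n)"

text \<open>The set function passed to \<open>measure_of\<close> is a measure, so the definition does not degenerate.\<close>

lemma sets_empirical_measure [simp]: "sets (empirical_measure n x) = sets borel"
  unfolding empirical_measure_def by (metis sets.sets_measure_of_eq space_borel)

lemma emeasure_empirical_measure:
  assumes "A \<in> sets borel"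
  shows "emeasure (empirical_measure n x) A =
           (\<Sum>k = 1..n. emeasure (return borel (x k)) A) / of_nat n"
proof (rule emeasure_measure_of[OF empirical_measure_def])
  let ?f = "\<lambda>A. (\<Sum>k = 1..n. emeasure (return borel (x k)) A) / of_nat n"
  show "countably_additive (sets (empirical_measure n x)) ?f"
  proof (rule countably_additiveI)
    fix F :: "nat \<Rightarrow> real set"
    assume F: "range F \<subseteq> sets (empirical_measure n x)" "disjoint_family F"
    have "(\<Sum>i. emeasure (return borel (x k)) (F i)) = emeasure (return borel (x k)) (\<Union>i. F i)" for k
      using F by (intro suminf_emeasure) auto
    then show "(\<Sum>i. ?f (F i)) = ?f (\<Union>i. F i)"
      by (simp add: divide_ennreal_def suminf_sum)
  qed
qed (use assms in \<open>auto simp: positive_def\<close>)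

definition ext_sqrt :: "ennreal \<Rightarrow> ennreal" where
  "ext_sqrt t = (if t = \<top> then \<top> else ennreal (sqrt (enn2real t)))"

definition couplings :: "real measure \<Rightarrow> real measure \<Rightarrow> (real \<times> real) measure set" where
  "couplings \<mu> \<nu> =
     {\<pi>. prob_space \<pi> \<and> sets \<pi> = sets borel \<and> distr \<pi> borel fst = \<mu> \<and> distr \<pi> borel snd = \<nu>}"

text \<open>Takes the value \<open>\<top>\<close> when no coupling has finite cost.\<close>

definition W2 :: "real measure \<Rightarrow> real measure \<Rightarrow> ennreal" where
  "W2 \<mu> \<nu> =
     ext_sqrt (INF \<pi>\<in>couplings \<mu> \<nu>. \<integral>\<^sup>+ (x, y). ennreal (\<bar>x - y\<bar>\<^sup>2) \<partial>\<pi>)"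

end

(*
  On configurations with the same ordering of coordinates the discrete energy is strongly convex,
  since - ln is convex and Q - rho x^2 is.  Hence for a Fekete point y and any configuration x with
  distinct coordinates, E_n(x) - Delta_n >= rho / n * sum |x_k - y_k|^2 when y is relabelled in the
  order of x.  Integrating over an independent sample x of nu turns the left side into
  E(nu) - Delta_n, while the right side becomes the cost of a coupling of nu and mu(y).

  For the limit, Delta_n <= I by the first part.  If Delta_n <= c < I infinitely often, then the
  corresponding empirical measures are tight, and Skorohod's representation and Fatou's lemma, with
  the logarithm truncated at distance 1/n to absorb the diagonal, give a limit of energy at most c.
*)

theory Submission
  imports Defs
begin

section \<open>Discrete energy\<close>

text \<open>The map - ln |u - v| is convex only while u - v keeps its sign, which forces the
  relabelling; it costs nothing because the discrete energy is symmetric in the points. Only pairs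
  of distinct indices enter that energy, and two distinct coordinates of an independent sample have
  joint law nu x nu, so its mean over the sample is E(nu) exactly, with no error term in n. On the
  measure side the obstacle is an integrand of both signs that may be infinite. A constant
  \<open>B\<close> making it nonnegative is fixed once and all integration is done in
  \<open>ennreal\<close>; since \<open>ennreal\<close> has only truncated subtraction, the
  inequalities carry \<open>B\<close> on both sides. The limit argument also needs the infimum I to
  be finite, which an explicit test measure provides.\<close>

definition offdiag :: "nat \<Rightarrow> (nat \<times> nat) set" where
  "offdiag n = {(i, j). i \<in> {1..n} \<and> j \<in> {1..n} \<and> i \<noteq> j}"

lemma finite_offdiag [simp]: "finite (offdiag n)"
  by (rule finite_subset[of _ "{1..n} \<times> {1..n}"]) (auto simp: offdiag_def)

lemma sum_offdiag_fst:
  fixes f :: "nat \<Rightarrow> 'a::comm_semiring_1"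
  shows "(\<Sum>(i, j)\<in>offdiag n. f i) = of_nat (n - 1) * (\<Sum>i=1..n. f i)"
proof -
  have "offdiag n = Sigma {1..n} (\<lambda>i. {1..n} - {i})"
    by (auto simp: offdiag_def)
  then have "(\<Sum>(i, j)\<in>offdiag n. f i) = (\<Sum>i=1..n. \<Sum>j\<in>{1..n} - {i}. f i)"
    by (subst sum.Sigma) auto
  also have "\<dots> = (\<Sum>i=1..n. of_nat (n - 1) * f i)"
    by (intro sum.cong) auto
  finally show ?thesis
    by (simp add: sum_distrib_left)
qed

lemma card_offdiag: "real (card (offdiag n)) = real n * (real n - 1)"
  using sum_offdiag_fst[of "\<lambda>_. 1::nat" n] by (cases n) (simp_all add: case_prod_beta algebra_simps)

lemma sum_offdiag_swap: "(\<Sum>(i, j)\<in>offdiag n. f i j) = (\<Sum>(i, j)\<in>offdiag n. f j i)"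
  by (rule sum.reindex_bij_witness[of _ prod.swap prod.swap]) (auto simp: offdiag_def)

lemma sum_offdiag_symmetric:
  fixes f :: "nat \<Rightarrow> nat \<Rightarrow> 'a::comm_semiring_1"
  assumes "\<And>i j. f i j = f j i"
  shows "(\<Sum>(i, j)\<in>offdiag n. f i j) = 2 * (\<Sum>(i, j)\<in>{(i, j). 1 \<le> i \<and> i < j \<and> j \<le> n}. f i j)"
proof -
  let ?U = "{(i, j). 1 \<le> i \<and> i < j \<and> j \<le> n}" and ?L = "{(i, j). 1 \<le> j \<and> j < i \<and> i \<le> n}"
  have eq: "offdiag n = ?U \<union> ?L"
    by (auto simp: offdiag_def)
  then have fin: "finite ?U" "finite ?L"
    using finite_offdiag[of n] by simp_all
  from eq have "(\<Sum>(i, j)\<in>offdiag n. f i j) = (\<Sum>(i, j)\<in>?U. f i j) + (\<Sum>(i, j)\<in>?L. f i j)"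
    using sum.union_disjoint[OF fin] by (simp add: disjoint_iff)
  also have "(\<Sum>(i, j)\<in>?L. f i j) = (\<Sum>(i, j)\<in>?U. f j i)"
    by (rule sum.reindex_bij_witness[of _ prod.swap prod.swap]) auto
  also have "(\<Sum>(i, j)\<in>?U. f j i) = (\<Sum>(i, j)\<in>?U. f i j)"
    using assms by metis
  finally show ?thesis
    by (simp add: mult_2)
qed

text \<open>Real-valued, so with \<open>ln 0 = 0\<close> coincident points get a meaningless finite
  value; the uses below keep the points distinct or treat the diagonal separately.\<close>

definition pair_energy :: "(real \<Rightarrow> real) \<Rightarrow> real \<Rightarrow> real \<Rightarrow> real" where
  "pair_energy Q x y = (Q x + Q y) / 2 - ln \<bar>x - y\<bar>"

text \<open>Every index lies in \<open>2 * (n - 1)\<close> ordered pairs, each giving it half of its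
  \<open>Q\<close>, so an average over pairs reproduces the external-field term. In this form the
  discrete energy averages the same two-point function that \<open>energy\<close>
  integrates.\<close>

definition config_energy :: "(real \<Rightarrow> real) \<Rightarrow> nat \<Rightarrow> (nat \<Rightarrow> real) \<Rightarrow> real" where
  "config_energy Q n x =
     (\<Sum>(i, j)\<in>offdiag n. pair_energy Q (x i) (x j)) / (real n * (real n - 1))"

text \<open>In \<open>ereal\<close> the sum of both infinities is \<infinity>, so a single infinite
  term would destroy the conclusion.\<close>

lemma sum_ereal_MInfty:
  fixes f :: "'a \<Rightarrow> ereal"
  assumes "finite A" "a \<in> A" "f a = -\<infinity>" "\<And>x. x \<in> A \<Longrightarrow> f x \<noteq> \<infinity>"
  shows "sum f A = -\<infinity>"
proof -
  have "sum f A = f a + sum f (A - {a})"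
    using assms by (simp add: sum.remove)
  moreover have "sum f (A - {a}) \<noteq> \<infinity>"
    using assms by (auto simp: sum_Pinfty)
  ultimately show ?thesis
    using assms by simp
qed

lemma discrete_energy_eq:
  assumes "2 \<le> n"
  shows "discrete_energy Q n x = (if inj_on x {1..n} then ereal (config_energy Q n x) else \<infinity>)"
proof (cases "inj_on x {1..n}")
  case True
  let ?U = "{(i, j). 1 \<le> i \<and> i < j \<and> j \<le> n}"
  have "(\<Sum>(i, j)\<in>?U. ext_log \<bar>x i - x j\<bar>) = (\<Sum>(i, j)\<in>?U. ereal (ln \<bar>x i - x j\<bar>))"
  proof (rule sum.cong[OF refl], clarify)
    fix i j assume "(1::nat) \<le> i" "i < j" "j \<le> n"
    then have "x i \<noteq> x j"
      using inj_onD[OF True, of i j] by auto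
    then show "ext_log \<bar>x i - x j\<bar> = ereal (ln \<bar>x i - x j\<bar>)"
      by (simp add: ext_log_def)
  qed
  also have "\<dots> = ereal (\<Sum>(i, j)\<in>?U. ln \<bar>x i - x j\<bar>)"
    by (simp add: sum_ereal case_prod_beta)
  also have "(\<Sum>(i, j)\<in>?U. ln \<bar>x i - x j\<bar>) = (\<Sum>(i, j)\<in>offdiag n. ln \<bar>x i - x j\<bar>) / 2"
    using sum_offdiag_symmetric[of "\<lambda>i j. ln \<bar>x i - x j\<bar>" n] by (simp add: abs_minus_commute)
  finally have U: "(\<Sum>(i, j)\<in>?U. ext_log \<bar>x i - x j\<bar>) = ereal ((\<Sum>(i, j)\<in>offdiag n. ln \<bar>x i - x j\<bar>) / 2)" .
  have "(\<Sum>(i, j)\<in>offdiag n. pair_energy Q (x i) (x j))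
      = ((\<Sum>(i, j)\<in>offdiag n. Q (x i)) + (\<Sum>(i, j)\<in>offdiag n. Q (x j))) / 2
        - (\<Sum>(i, j)\<in>offdiag n. ln \<bar>x i - x j\<bar>)"
    by (simp add: pair_energy_def case_prod_beta sum_subtractf sum.distrib flip: sum_divide_distrib)
  also have "(\<Sum>(i, j)\<in>offdiag n. Q (x j)) = (\<Sum>(i, j)\<in>offdiag n. Q (x i))"
    by (rule sum_offdiag_swap)
  also have "(\<Sum>(i, j)\<in>offdiag n. Q (x i)) = (real n - 1) * (\<Sum>i=1..n. Q (x i))"
    using assms by (simp add: sum_offdiag_fst of_nat_diff)
  finally have "config_energy Q n x = 1 / real n * (\<Sum>i=1..n. Q (x i))
      - 2 / (real n * (real n - 1)) * ((\<Sum>(i, j)\<in>offdiag n. ln \<bar>x i - x j\<bar>) / 2)"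
    using assms by (simp add: config_energy_def add_divide_distrib diff_divide_distrib)
  then show ?thesis
    using True unfolding discrete_energy_def U by simp
next
  case False
  then obtain a b where ab: "a \<in> {1..n}" "b \<in> {1..n}" "x a = x b" "a < b"
    unfolding inj_on_def by (metis linorder_neqE_nat)
  let ?U = "{(i, j). 1 \<le> i \<and> i < j \<and> j \<le> n}"
  have "(\<Sum>(i, j)\<in>?U. ext_log \<bar>x i - x j\<bar>) = -\<infinity>"
  proof (rule sum_ereal_MInfty)
    show "finite ?U"
      by (rule finite_subset[of _ "{1..n} \<times> {1..n}"]) auto
    show "(a, b) \<in> ?U" "(case (a, b) of (i, j) \<Rightarrow> ext_log \<bar>x i - x j\<bar>) = -\<infinity>"
      using ab by (auto simp: ext_log_def)
  qed (simp add: ext_log_def case_prod_beta)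
  moreover have "2 / (real n * (real n - 1)) > 0"
    using assms by simp
  ultimately show ?thesis
    using False assms unfolding discrete_energy_def by simp
qed

lemma config_energy_cong:
  assumes "\<And>i. i \<in> {1..n} \<Longrightarrow> x i = y i"
  shows "config_energy Q n x = config_energy Q n y"
proof -
  have "(\<Sum>(i, j)\<in>offdiag n. pair_energy Q (x i) (x j)) = (\<Sum>(i, j)\<in>offdiag n. pair_energy Q (y i) (y j))"
    by (intro sum.cong) (auto simp: offdiag_def assms)
  then show ?thesis
    by (simp add: config_energy_def)
qed

lemma min_discrete_energy_le:
  assumes "2 \<le> n" "inj_on x {1..n}"
  shows "min_discrete_energy Q n \<le> ereal (config_energy Q n x)"
proof -
  \<comment> \<open>The infimum ranges over extensional vectors only; \<open>config_energy\<close>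
    does not see the cut-off.\<close>
  let ?x = "restrict x {1..n}"
  have "min_discrete_energy Q n \<le> discrete_energy Q n ?x"
    unfolding min_discrete_energy_def by (intro INF_lower) (simp add: vecs_def)
  also have "\<dots> = ereal (config_energy Q n x)"
    using assms config_energy_cong[of n ?x x Q] by (simp add: discrete_energy_eq inj_on_restrict_eq)
  finally show ?thesis .
qed

text \<open>Testing with the points 1, ..., n shows that the minimum is finite, whereas a vector
  with a repeated coordinate has infinite energy.\<close>

lemma fekete_pointD:
  assumes "2 \<le> n" "fekete_point Q n y"
  shows "inj_on y {1..n}" "min_discrete_energy Q n = ereal (config_energy Q n y)"
proof -
  have "min_discrete_energy Q n \<le> ereal (config_energy Q n real)"
    using assms by (intro min_discrete_energy_le) auto
  then show "inj_on y {1..n}" "min_discrete_energy Q n = ereal (config_energy Q n y)"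
    using assms discrete_energy_eq[of n Q y] by (auto simp: fekete_point_def split: if_splits)
qed

text \<open>Lets a Fekete point be relabelled in the order of another configuration while remaining
  a minimizer.\<close>

lemma config_energy_permute:
  assumes "bij_betw s {1..n} {1..n}"
  shows "config_energy Q n (\<lambda>i. y (s i)) = config_energy Q n y"
proof -
  have s: "inj_on s {1..n}" "s ` {1..n} = {1..n}"
    using assms by (auto simp: bij_betw_def)
  have "bij_betw (map_prod s s) (offdiag n) (offdiag n)"
  proof (rule bij_betw_imageI)
    show inj: "inj_on (map_prod s s) (offdiag n)"
      by (rule inj_on_subset[OF map_prod_inj_on[OF s(1) s(1)]]) (auto simp: offdiag_def)
    have "s i \<in> {1..n} \<and> s j \<in> {1..n} \<and> s i \<noteq> s j" if "(i, j) \<in> offdiag n" for i j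
      using that s inj_onD[OF s(1), of i j] unfolding offdiag_def by blast
    then have "map_prod s s ` offdiag n \<subseteq> offdiag n"
      by (auto simp: offdiag_def)
    then show "map_prod s s ` offdiag n = offdiag n"
      using inj by (intro card_subset_eq) (auto simp: card_image)
  qed
  then show ?thesis
    unfolding config_energy_def
    by (subst sum.reindex_bij_betw[symmetric]) (auto simp: case_prod_beta)
qed

section \<open>Ranks\<close>

text \<open>Counting, instead of sorting, keeps the rank measurable as a function of
  \<open>x\<close>, which the random coupling requires. With \<le> in place of < the ranks start at
  1.\<close>

definition rank_on :: "('a \<Rightarrow> real) \<Rightarrow> 'a set \<Rightarrow> 'a \<Rightarrow> nat" where
  "rank_on x A k = card {j \<in> A. x j \<le> x k}"

lemma rank_on_less_iff:
  assumes "finite A" "i \<in> A" "j \<in> A"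
  shows "rank_on x A i < rank_on x A j \<longleftrightarrow> x i < x j"
proof
  assume "x i < x j"
  then have "{k \<in> A. x k \<le> x i} \<subset> {k \<in> A. x k \<le> x j}"
    using assms by force
  then show "rank_on x A i < rank_on x A j"
    unfolding rank_on_def using assms by (intro psubset_card_mono) auto
next
  assume *: "rank_on x A i < rank_on x A j"
  show "x i < x j"
  proof (rule ccontr)
    assume "\<not> x i < x j"
    then have "{k \<in> A. x k \<le> x j} \<subseteq> {k \<in> A. x k \<le> x i}"
      by auto
    then have "rank_on x A j \<le> rank_on x A i"
      unfolding rank_on_def using assms by (intro card_mono) auto
    with * show False by simp
  qed
qed

lemma rank_on_bij:
  assumes "finite A" "inj_on x A"
  shows "bij_betw (rank_on x A) A {1..card A}"
proof (rule bij_betw_imageI)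
  show inj: "inj_on (rank_on x A) A"
  proof (rule inj_onI)
    fix i j assume "i \<in> A" "j \<in> A" "rank_on x A i = rank_on x A j"
    then have "x i = x j"
      using rank_on_less_iff[OF assms(1), of i j x] rank_on_less_iff[OF assms(1), of j i x] by force
    then show "i = j"
      using assms(2) \<open>i \<in> A\<close> \<open>j \<in> A\<close> by (auto dest: inj_onD)
  qed
  have "rank_on x A ` A \<subseteq> {1..card A}"
  proof clarify
    fix k assume "k \<in> A"
    then have "{j \<in> A. x j \<le> x k} \<noteq> {}" by auto
    then have "0 < rank_on x A k"
      unfolding rank_on_def using assms by (simp add: card_gt_0_iff)
    moreover have "rank_on x A k \<le> card A"
      unfolding rank_on_def using assms by (intro card_mono) auto
    ultimately show "rank_on x A k \<in> {1..card A}" by simp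
  qed
  then show "rank_on x A ` A = {1..card A}"
    using inj by (intro card_subset_eq) (auto simp: card_image)
qed

text \<open>The index map for which \<open>y \<circ> rearrange n y x\<close> is ordered like \<open>x\<close>.\<close>

definition rearrange :: "nat \<Rightarrow> (nat \<Rightarrow> real) \<Rightarrow> (nat \<Rightarrow> real) \<Rightarrow> nat \<Rightarrow> nat" where
  "rearrange n y x k = the_inv_into {1..n} (rank_on y {1..n}) (rank_on x {1..n} k)"

lemma rearrange_bij:
  assumes "inj_on x {1..n}" "inj_on y {1..n}"
  shows "bij_betw (rearrange n y x) {1..n} {1..n}"
proof -
  have "bij_betw (rank_on x {1..n}) {1..n} {1..n}"
    "bij_betw (the_inv_into {1..n} (rank_on y {1..n})) {1..n} {1..n}"
    using assms rank_on_bij[of "{1..n}"] by (auto intro!: bij_betw_the_inv_into)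
  then show ?thesis
    using bij_betw_trans by (fastforce simp: rearrange_def[abs_def] comp_def)
qed

lemma rearrange_less_iff:
  assumes "inj_on x {1..n}" "inj_on y {1..n}" "i \<in> {1..n}" "j \<in> {1..n}"
  shows "y (rearrange n y x i) < y (rearrange n y x j) \<longleftrightarrow> x i < x j"
proof -
  let ?A = "{1..n}"
  \<comment> \<open>Matched entries have equal ranks by construction, and ranks reflect the strict
    order on both sides.\<close>
  have "rank_on y ?A (rearrange n y x k) = rank_on x ?A k" if "k \<in> ?A" for k
    unfolding rearrange_def using that assms rank_on_bij[of ?A x] rank_on_bij[of ?A y]
    by (intro f_the_inv_into_f) (auto simp: bij_betw_def)
  moreover have "rearrange n y x k \<in> ?A" if "k \<in> ?A" for k
    using rearrange_bij[OF assms(1,2)] that by (auto simp: bij_betw_def)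
  ultimately show ?thesis
    using assms by (metis finite_atLeastAtMost rank_on_less_iff)
qed

section \<open>Strong convexity\<close>

text \<open>Rests on the identity \<open>(1 - t) * u^2 + t * v^2 - ((1 - t) * u + t * v)^2 = t * (1
  - t) * (v - u)^2\<close>.\<close>

lemma strongly_convexD:
  fixes Q :: "real \<Rightarrow> real"
  assumes "convex_on UNIV (\<lambda>x. Q x - \<rho> * x\<^sup>2)" "0 \<le> t" "t \<le> 1"
  shows "Q ((1 - t) * u + t * v) \<le> (1 - t) * Q u + t * Q v - \<rho> * t * (1 - t) * (v - u)\<^sup>2"
proof -
  have "Q ((1 - t) * u + t * v) - \<rho> * ((1 - t) * u + t * v)\<^sup>2
      \<le> (1 - t) * (Q u - \<rho> * u\<^sup>2) + t * (Q v - \<rho> * v\<^sup>2)"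
    using convex_onD[OF assms(1), of t u v] assms by simp
  then show ?thesis
    by (simp add: power2_eq_square algebra_simps)
qed

text \<open>When both pairs are ordered alike, the two differences have the same sign, so the
  distance of the interpolated points is the interpolated distance and concavity of
  \<open>ln\<close> applies. The quadratic gain comes from \<open>Q\<close> alone.\<close>

lemma pair_energy_strongly_convex:
  assumes "convex_on UNIV (\<lambda>x. Q x - \<rho> * x\<^sup>2)" "0 < t" "t < 1"
    and "z < z' \<and> x < x' \<or> z' < z \<and> x' < x"
  shows "pair_energy Q ((1 - t) * z + t * x) ((1 - t) * z' + t * x')
    \<le> (1 - t) * pair_energy Q z z' + t * pair_energy Q x x'
      - \<rho> * t * (1 - t) * ((x - z)\<^sup>2 + (x' - z')\<^sup>2) / 2"
proof -
  let ?d = "\<bar>z - z'\<bar>" and ?e = "\<bar>x - x'\<bar>"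
  have abs: "\<bar>((1 - t) * z + t * x) - ((1 - t) * z' + t * x')\<bar> = (1 - t) * ?d + t * ?e"
  proof -
    have "((1 - t) * z + t * x) - ((1 - t) * z' + t * x') = (1 - t) * (z - z') + t * (x - x')"
      by (simp add: algebra_simps)
    moreover have "\<bar>(1 - t) * (z - z') + t * (x - x')\<bar> = (1 - t) * ?d + t * ?e"
      using assms(4)
    proof
      assume "z < z' \<and> x < x'"
      then have "(1 - t) * (z - z') < 0" "t * (x - x') < 0"
        using assms by (auto simp: mult_pos_neg)
      with \<open>z < z' \<and> x < x'\<close> show ?thesis
        by (simp add: algebra_simps)
    next
      assume "z' < z \<and> x' < x"
      then have "(1 - t) * (z - z') > 0" "t * (x - x') > 0"
        using assms by auto
      with \<open>z' < z \<and> x' < x\<close> show ?thesis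
        by (simp add: algebra_simps)
    qed
    ultimately show ?thesis by simp
  qed
  have "(1 - t) * ln ?d + t * ln ?e \<le> ln ((1 - t) * ?d + t * ?e)"
    using concave_onD[OF ln_concave, of t ?d ?e] assms by auto
  moreover note strongly_convexD[OF assms(1), of t z x] strongly_convexD[OF assms(1), of t z' x']
  moreover have "(1 - t) * pair_energy Q z z' + t * pair_energy Q x x'
      - \<rho> * t * (1 - t) * ((x - z)\<^sup>2 + (x' - z')\<^sup>2) / 2
    = (((1 - t) * Q z + t * Q x - \<rho> * t * (1 - t) * (x - z)\<^sup>2)
      + ((1 - t) * Q z' + t * Q x' - \<rho> * t * (1 - t) * (x' - z')\<^sup>2)) / 2
      - ((1 - t) * ln ?d + t * ln ?e)"
    by (simp add: pair_energy_def field_simps)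
  ultimately show ?thesis
    using assms(2,3) unfolding pair_energy_def[of Q "_ + _"] abs by (smt (verit) divide_right_mono)
qed

text \<open>The minimizer is compared with the point of weight \<open>t\<close> towards it on the
  segment from \<open>x\<close>. Strong convexity leaves a common factor \<open>1 - t\<close>; once
  it is cancelled, \<open>t\<close> tends to 1.\<close>

lemma config_energy_gap:
  assumes "0 \<le> \<rho>" "convex_on UNIV (\<lambda>x. Q x - \<rho> * x\<^sup>2)" "2 \<le> n"
    and x: "inj_on x {1..n}" and y: "inj_on y {1..n}"
    and min: "\<And>u. inj_on u {1..n} \<Longrightarrow> config_energy Q n y \<le> config_energy Q n u"
  shows "\<rho> / real n * (\<Sum>k=1..n. (x k - y (rearrange n y x k))\<^sup>2) \<le> config_energy Q n x - config_energy Q n y"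
proof -
  define z where "z = (\<lambda>k. y (rearrange n y x k))"
  define N where "N = real n * (real n - 1)"
  define S where "S = (\<Sum>k=1..n. (x k - z k)\<^sup>2) / real n"
  have N: "N > 0"
    using assms by (simp add: N_def)
  have E: "N * config_energy Q n u = (\<Sum>(i, j)\<in>offdiag n. pair_energy Q (u i) (u j))" for u
    using N unfolding config_energy_def N_def[symmetric] by simp
  have Ez: "config_energy Q n z = config_energy Q n y"
    unfolding z_def by (rule config_energy_permute[OF rearrange_bij[OF x y]])
  have order: "z i < z j \<and> x i < x j \<or> z j < z i \<and> x j < x i" if "(i, j) \<in> offdiag n" for i j
  proof -
    have "i \<in> {1..n}" "j \<in> {1..n}" "x i \<noteq> x j"
      using that inj_onD[OF x, of i j] by (auto simp: offdiag_def)
    then show ?thesis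
      using rearrange_less_iff[OF x y] unfolding z_def by (metis linorder_neqE_linordered_idom)
  qed
  have "t * (\<rho> * S) \<le> config_energy Q n x - config_energy Q n y" if "0 < t" "t < 1" for t
  proof -
    let ?s = "1 - t"
    define w where "w = (\<lambda>i. t * z i + ?s * x i)"
    have w: "pair_energy Q (w i) (w j) \<le> t * pair_energy Q (z i) (z j) + ?s * pair_energy Q (x i) (x j)
        - \<rho> * ?s * t * ((x i - z i)\<^sup>2 + (x j - z j)\<^sup>2) / 2" if "(i, j) \<in> offdiag n" for i j
      using pair_energy_strongly_convex[OF assms(2), of ?s "z i" "z j" "x i" "x j"] order[OF that] \<open>0 < t\<close> \<open>t < 1\<close>
      unfolding w_def by simp
    \<comment> \<open>Equal order at both ends keeps the interpolated coordinates distinct, so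
      \<open>w\<close> is a legitimate competitor.\<close>
    have "w i \<noteq> w j" if "(i, j) \<in> offdiag n" for i j
      using order[OF that] that \<open>0 < t\<close> \<open>t < 1\<close> unfolding w_def
      by (smt (verit, best) mult_strict_left_mono)
    then have "inj_on w {1..n}"
      by (intro inj_onI) (auto simp: offdiag_def)
    then have "config_energy Q n y \<le> config_energy Q n w"
      by (rule min)
    also have "N * config_energy Q n w = (\<Sum>(i, j)\<in>offdiag n. pair_energy Q (w i) (w j))"
      by (rule E)
    also have "\<dots> \<le> (\<Sum>(i, j)\<in>offdiag n. t * pair_energy Q (z i) (z j) + ?s * pair_energy Q (x i) (x j)
        - \<rho> * ?s * t * ((x i - z i)\<^sup>2 + (x j - z j)\<^sup>2) / 2)"
      by (intro sum_mono) (use w in auto)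
    also have "\<dots> = t * (\<Sum>(i, j)\<in>offdiag n. pair_energy Q (z i) (z j))
        + ?s * (\<Sum>(i, j)\<in>offdiag n. pair_energy Q (x i) (x j))
        - \<rho> * ?s * t / 2 * ((\<Sum>(i, j)\<in>offdiag n. (x i - z i)\<^sup>2) + (\<Sum>(i, j)\<in>offdiag n. (x j - z j)\<^sup>2))"
      by (simp add: case_prod_beta sum.distrib sum_subtractf sum_distrib_left distrib_left sum_divide_distrib add_divide_distrib mult.assoc)
    also have "(\<Sum>(i, j)\<in>offdiag n. (x j - z j)\<^sup>2) = (\<Sum>(i, j)\<in>offdiag n. (x i - z i)\<^sup>2)"
      by (rule sum_offdiag_swap)
    \<comment> \<open>Each index is the first entry of \<open>n - 1\<close> pairs, and
      \<open>N = n * (n - 1)\<close>: this is where the factor 1/n in \<open>S\<close> comes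
      from.\<close>
    also have "(\<Sum>(i, j)\<in>offdiag n. (x i - z i)\<^sup>2) = N * S"
      using assms by (simp add: sum_offdiag_fst of_nat_diff S_def N_def)
    also note E[of z, symmetric]
    also note E[of x, symmetric]
    finally have "N * config_energy Q n y \<le> N * (t * config_energy Q n z + ?s * config_energy Q n x - \<rho> * ?s * t * S)"
      using N by (simp add: field_simps)
    then have "config_energy Q n y \<le> t * config_energy Q n y + ?s * config_energy Q n x - \<rho> * ?s * t * S"
      using N Ez by simp
    then have "?s * (t * (\<rho> * S)) \<le> ?s * (config_energy Q n x - config_energy Q n y)"
      by (simp add: algebra_simps)
    then show ?thesis
      using that by simp
  qed
  then have "\<rho> * S \<le> config_energy Q n x - config_energy Q n y"
    by (rule field_le_mult_one_interval)
  then show ?thesis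
    by (simp add: S_def z_def)
qed

section \<open>Coercivity of the external field and the shifted kernel\<close>

lemma strongly_convex_coercive:
  fixes Q :: "real \<Rightarrow> real"
  assumes "0 < \<rho>" "convex_on UNIV (\<lambda>x. Q x - \<rho> * x\<^sup>2)"
  obtains B where "0 \<le> B" "\<And>x. 4 * \<bar>x\<bar> - B \<le> Q x"
proof -
  define g where "g = (\<lambda>x. Q x - \<rho> * x\<^sup>2)"
  \<comment> \<open>The chords of \<open>g\<close> from 0 to 1 and to -1 limit its linear decay; the
    additional 4 is the slope wanted in the conclusion.\<close>
  define L where "L = \<bar>g 1 - g 0\<bar> + \<bar>g (-1) - g 0\<bar> + 4"
  have g: "g 0 - (L - 4) * \<bar>x\<bar> \<le> g x" for x
  proof -
    \<comment> \<open>Used with 0 as a convex combination of \<open>x\<close> and the unit point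
      \<open>e\<close> on the opposite side; the weight of \<open>x\<close> is
      \<open>1 / (1 + \<bar>x\<bar>)\<close>.\<close>
    have *: "g 0 \<le> (1 - s) * g e + s * g x" if "s * x + (1 - s) * e = 0" "0 < s" "s < 1" for e s
      using convex_onD[OF assms(2), of s e x] that by (simp add: g_def add.commute)
    consider "x = 0" | "x > 0" | "x < 0" by linarith
    then show ?thesis
    proof cases
      case 2
      then have "g 0 \<le> (1 - 1 / (1 + x)) * g (-1) + 1 / (1 + x) * g x"
        by (intro *) (auto simp: field_simps)
      also have "\<dots> = (x * g (-1) + g x) / (1 + x)"
        using 2 by (simp add: divide_simps)
      finally have "g 0 \<le> g x + x * (g (-1) - g 0)"
        using 2 by (simp add: pos_le_divide_eq algebra_simps)
      moreover have "x * (g (-1) - g 0) \<le> x * (L - 4)"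
        using 2 unfolding L_def by (intro mult_left_mono) auto
      ultimately have "g 0 - x * (L - 4) \<le> g x"
        by linarith
      then show ?thesis using 2 by (simp add: mult.commute)
    next
      case 3
      then have "g 0 \<le> (1 - 1 / (1 - x)) * g 1 + 1 / (1 - x) * g x"
        by (intro *) (auto simp: field_simps)
      also have "\<dots> = ((-x) * g 1 + g x) / (1 - x)"
        using 3 by (simp add: divide_simps)
      finally have "g 0 \<le> g x + (-x) * (g 1 - g 0)"
        using 3 by (simp add: pos_le_divide_eq algebra_simps)
      moreover have "(-x) * (g 1 - g 0) \<le> (-x) * (L - 4)"
        using 3 unfolding L_def by (intro mult_left_mono) auto
      ultimately have "g 0 - (-x) * (L - 4) \<le> g x"
        by linarith
      then show ?thesis using 3 by (simp add: mult.commute)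
    qed simp
  qed
  \<comment> \<open>Completing the square, \<open>\<rho> * x^2 - L * \<bar>x\<bar>\<close> is at
    least \<open>- L^2 / (4 * \<rho>)\<close>; the absolute value only secures
    \<open>0 \<le> B\<close>.\<close>
  define B where "B = \<bar>L\<^sup>2 / (4 * \<rho>) - g 0\<bar>"
  have "4 * \<bar>x\<bar> - B \<le> Q x" for x
  proof -
    have "0 \<le> (2 * \<rho> * \<bar>x\<bar> - L)\<^sup>2 / (4 * \<rho>)"
      using assms by simp
    also have "\<dots> = \<rho> * x\<^sup>2 - L * \<bar>x\<bar> + L\<^sup>2 / (4 * \<rho>)"
      using assms by (simp add: field_simps power2_eq_square)
    finally show ?thesis
      using g[of x] unfolding B_def g_def by (simp add: algebra_simps)
  qed
  then show ?thesis
    using that[of B] by (simp add: B_def)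
qed

lemma ln_abs_le: "ln \<bar>x - y\<bar> \<le> \<bar>x - y\<bar>" for x y :: real
  using ln_bound[of "\<bar>x - y\<bar>"] by (cases "x = y") auto

text \<open>
  The slope 4 in \<open>coercive\<close> leaves room to absorb the logarithm, so that pair energies are at least
  \<open>- B\<close> and control \<open>Q\<close> itself.
\<close>

locale external_field =
  fixes Q :: "real \<Rightarrow> real" and \<rho> B :: real
  assumes rho_pos: "0 < \<rho>"
    and strongly_convex: "convex_on UNIV (\<lambda>x. Q x - \<rho> * x\<^sup>2)"
    and B_nonneg: "0 \<le> B"
    and coercive: "\<And>x. 4 * \<bar>x\<bar> - B \<le> Q x"
begin

lemma continuous_on_Q: "continuous_on UNIV Q"
proof -
  have "continuous_on UNIV (\<lambda>x. (Q x - \<rho> * x\<^sup>2) + \<rho> * x\<^sup>2)"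
    by (intro continuous_on_add convex_on_continuous[OF open_UNIV strongly_convex] continuous_intros)
  then show ?thesis
    by (rule continuous_on_eq) auto
qed

lemma measurable_Q [measurable]: "Q \<in> borel_measurable borel"
  using continuous_on_Q by (rule borel_measurable_continuous_onI)

text \<open>The energy integrand raised by \<open>B\<close>, which makes it nonnegative. The
  diagonal is set to \<top> by hand because \<open>ln 0 = 0\<close>.\<close>

definition kernel :: "real \<Rightarrow> real \<Rightarrow> ennreal" where
  "kernel x y = (if x = y then \<top> else ennreal (pair_energy Q x y + B))"

lemma measurable_kernel [measurable]: "(\<lambda>(x, y). kernel x y) \<in> borel_measurable (borel \<Otimes>\<^sub>M borel)"
  unfolding kernel_def pair_energy_def by measurable

text \<open>Half of the external field pays for the logarithm, as \<open>(Q x + Q y) / 4\<close> is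
  at least \<open>\<bar>x\<bar> + \<bar>y\<bar> - B / 2\<close>; the other half is kept to control
  \<open>Q\<close>. The free \<open>l\<close> also covers the truncated logarithm.\<close>

lemma pair_energy_ge:
  assumes "l \<le> \<bar>x - y\<bar>"
  shows "(Q x + Q y) / 4 - B / 2 \<le> (Q x + Q y) / 2 - l"
  using assms coercive[of x] coercive[of y] by argo

lemma pair_energy_ge': "(Q x + Q y) / 4 - B / 2 \<le> pair_energy Q x y"
  unfolding pair_energy_def using pair_energy_ge ln_abs_le by blast

lemma pair_energy_nonneg: "0 \<le> pair_energy Q x y + B"
  using pair_energy_ge'[of x y] coercive[of x] coercive[of y] by argo

text \<open>Pointwise, positive part plus \<open>B\<close> equals kernel plus negative part. After
  integration the negative part is at most \<open>B\<close>, hence finite, and may be moved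
  across.\<close>

lemma energy_eq:
  assumes "real_distribution \<mu>"
  shows "energy Q \<mu> = enn2ereal (\<integral>\<^sup>+ (x, y). kernel x y \<partial>(\<mu> \<Otimes>\<^sub>M \<mu>)) - ereal B"
proof -
  interpret real_distribution \<mu> by fact
  interpret P: pair_prob_space \<mu> \<mu> ..
  let ?M = "\<mu> \<Otimes>\<^sub>M \<mu>"
  let ?f = "\<lambda>(x, y). ereal ((Q x + Q y) / 2) - ext_log \<bar>x - y\<bar>"
  have [measurable_cong]: "sets \<mu> = sets borel" by simp
  have [measurable]: "?f \<in> borel_measurable (borel \<Otimes>\<^sub>M borel)"
    unfolding ext_log_def by measurable
  have split: "e2ennreal (?f p) + ennreal B = (case p of (x, y) \<Rightarrow> kernel x y) + e2ennreal (- ?f p)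
      \<and> e2ennreal (- ?f p) \<le> ennreal B" for p
  proof (cases p)
    case (Pair x y)
    show ?thesis
    proof (cases "x = y")
      case True
      then show ?thesis by (simp add: Pair kernel_def ext_log_def e2ennreal_neg)
    next
      case False
      define a where "a = pair_energy Q x y"
      have f: "?f p = ereal a"
        using False by (simp add: Pair ext_log_def a_def pair_energy_def)
      have a: "0 \<le> a + B"
        unfolding a_def by (rule pair_energy_nonneg)
      have "ennreal a + ennreal B = ennreal (a + B) + ennreal (- a) \<and> ennreal (- a) \<le> ennreal B"
      proof (cases "0 \<le> a")
        case True
        then show ?thesis using B_nonneg by (simp add: ennreal_plus ennreal_neg)
      next
        case False
        then show ?thesis using a B_nonneg
          by (auto simp: ennreal_neg ennreal_leI simp flip: ennreal_plus)
      qed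
      then show ?thesis
        unfolding f using False by (simp add: Pair kernel_def a_def)
    qed
  qed
  have "(\<integral>\<^sup>+ p. e2ennreal (?f p) \<partial>?M) + ennreal B = (\<integral>\<^sup>+ p. e2ennreal (?f p) + ennreal B \<partial>?M)"
    by (subst nn_integral_add) (auto simp: P.emeasure_space_1)
  also have "\<dots> = (\<integral>\<^sup>+ p. (case p of (x, y) \<Rightarrow> kernel x y) + e2ennreal (- ?f p) \<partial>?M)"
    using split by simp
  also have "\<dots> = (\<integral>\<^sup>+ (x, y). kernel x y \<partial>?M) + (\<integral>\<^sup>+ p. e2ennreal (- ?f p) \<partial>?M)"
    by (rule nn_integral_add) measurable
  finally have eq: "(\<integral>\<^sup>+ p. e2ennreal (?f p) \<partial>?M) + ennreal B
      = (\<integral>\<^sup>+ (x, y). kernel x y \<partial>?M) + (\<integral>\<^sup>+ p. e2ennreal (- ?f p) \<partial>?M)" .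
  have "(\<integral>\<^sup>+ p. e2ennreal (- ?f p) \<partial>?M) \<le> (\<integral>\<^sup>+ p. ennreal B \<partial>?M)"
    using split by (intro nn_integral_mono) auto
  also have "\<dots> = ennreal B"
    by (simp add: P.emeasure_space_1)
  finally have le: "(\<integral>\<^sup>+ p. e2ennreal (- ?f p) \<partial>?M) \<le> ennreal B" .
  have "enn2ereal a - enn2ereal b = enn2ereal c - ereal B" if "a + ennreal B = c + b" "b \<le> ennreal B" for a b c
    using that B_nonneg
    by (cases a; cases b; cases c)
       (auto simp: top_unique enn2ereal_ennreal simp flip: ennreal_plus)
  from this[OF eq le] show ?thesis
    unfolding energy_def ereal_integral_def .
qed

end

section \<open>Coupling by ranks\<close>

text \<open>Independence of two distinct coordinates, checked on rectangles, whose preimages are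
  cylinders. It turns each off-diagonal term of the sample energy into the full double
  integral.\<close>

lemma distr_PiM_pair:
  assumes "prob_space M" "i \<in> I" "j \<in> I" "i \<noteq> j"
  shows "distr (Pi\<^sub>M I (\<lambda>_. M)) (M \<Otimes>\<^sub>M M) (\<lambda>x. (x i, x j)) = M \<Otimes>\<^sub>M M"
proof (rule pair_measure_eqI[symmetric])
  interpret prob_space M by fact
  show "sigma_finite_measure M" "sigma_finite_measure M"
    by unfold_locales
  fix A B assume AB: "A \<in> sets M" "B \<in> sets M"
  let ?P = "Pi\<^sub>M I (\<lambda>_. M)" and ?S = "\<lambda>k. if k = i then A else B"
  have eq: "(\<lambda>x. (x i, x j)) -` (A \<times> B) \<inter> space ?P = prod_emb I (\<lambda>_. M) {i, j} (Pi\<^sub>E {i, j} ?S)"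
    using assms by (auto simp: prod_emb_def space_PiM PiE_iff)
  have "emeasure (distr ?P (M \<Otimes>\<^sub>M M) (\<lambda>x. (x i, x j))) (A \<times> B)
      = emeasure ?P ((\<lambda>x. (x i, x j)) -` (A \<times> B) \<inter> space ?P)"
    using assms AB by (intro emeasure_distr) auto
  also have "\<dots> = (\<Prod>k\<in>{i, j}. emeasure M (?S k))"
    unfolding eq using assms AB by (intro emeasure_PiM_emb) auto
  also have "\<dots> = emeasure M A * emeasure M B"
    using assms by simp
  finally show "emeasure M A * emeasure M B = emeasure (distr ?P (M \<Otimes>\<^sub>M M) (\<lambda>x. (x i, x j))) (A \<times> B)" ..
qed simp

lemma nn_integral_uniform_count_measure_pair:
  assumes "sigma_finite_measure M" "finite A"
    and "f \<in> borel_measurable (uniform_count_measure A \<Otimes>\<^sub>M M)"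
  shows "(\<integral>\<^sup>+ p. f p \<partial>(uniform_count_measure A \<Otimes>\<^sub>M M)) = (\<Sum>k\<in>A. ennreal (1 / card A) * (\<integral>\<^sup>+ x. f (k, x) \<partial>M))"
proof -
  interpret sigma_finite_measure M by fact
  have "(\<integral>\<^sup>+ p. f p \<partial>(uniform_count_measure A \<Otimes>\<^sub>M M)) = (\<integral>\<^sup>+ k. \<integral>\<^sup>+ x. f (k, x) \<partial>M \<partial>uniform_count_measure A)"
    using nn_integral_fst[OF assms(3)] by simp
  then show ?thesis
    using assms(2) by (simp add: uniform_count_measure_def nn_integral_point_measure_finite)
qed

lemma measurable_PiM_coordinate:
  assumes "k \<in> I" "sets M = sets borel"
  shows "(\<lambda>x. x k) \<in> borel_measurable (Pi\<^sub>M I (\<lambda>_. M))"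
  using measurable_component_singleton[OF assms(1), of "\<lambda>_. M"] measurable_cong_sets[OF refl assms(2)]
  by blast

text \<open>The matched entry depends on \<open>x\<close> only through a rank, which counts
  measurable comparisons; on the discrete space of ranks every function is measurable.\<close>

lemma measurable_rearrange:
  assumes "k \<in> {1..n}" "sets M = sets borel"
  shows "(\<lambda>x. (y (rearrange n y x k) :: real)) \<in> borel_measurable (Pi\<^sub>M {1..n} (\<lambda>_. M))"
proof -
  have coord: "(\<lambda>x. x k) \<in> borel_measurable (Pi\<^sub>M {1..n} (\<lambda>_. M))" if "k \<in> {1..n}" for k
    using that assms(2) by (rule measurable_PiM_coordinate)
  have "{x \<in> space (Pi\<^sub>M {1..n} (\<lambda>_. M)). j \<in> {j \<in> {1..n}. x j \<le> x k}} \<in> sets (Pi\<^sub>M {1..n} (\<lambda>_. M))" for j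
    using borel_measurable_le[OF coord[of j] coord[OF assms(1)]] by (cases "j \<in> {1..n}") simp_all
  then have "(\<lambda>x. rank_on x {1..n} k) \<in> measurable (Pi\<^sub>M {1..n} (\<lambda>_. M)) (count_space UNIV)"
    unfolding rank_on_def by (rule measurable_card)
  then show ?thesis
    unfolding rearrange_def by (rule measurable_compose) simp
qed

context external_field
begin

text \<open>
  Pair each coordinate of an independent sample of \<open>\<nu>\<close> with the entry of \<open>y\<close> of the same rank.
  A uniformly chosen coordinate then gives a coupling of \<open>\<nu>\<close> with the empirical measure of \<open>y\<close>.
\<close>

lemma coupling_cost_le:
  assumes "real_distribution \<nu>" "2 \<le> n" and y: "inj_on y {1..n}"
    and min: "\<And>u. inj_on u {1..n} \<Longrightarrow> config_energy Q n y \<le> config_energy Q n u"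
    and fin: "(\<integral>\<^sup>+ (x, y). kernel x y \<partial>(\<nu> \<Otimes>\<^sub>M \<nu>)) \<noteq> \<top>"
  obtains \<pi> where "\<pi> \<in> couplings \<nu> (empirical_measure n y)"
    "ennreal \<rho> * (\<integral>\<^sup>+ (x, y). ennreal (\<bar>x - y\<bar>\<^sup>2) \<partial>\<pi>) + ennreal (config_energy Q n y + B)
      \<le> (\<integral>\<^sup>+ (x, y). kernel x y \<partial>(\<nu> \<Otimes>\<^sub>M \<nu>))"
proof -
  interpret real_distribution \<nu> by fact
  define P where "P = Pi\<^sub>M {1..n} (\<lambda>_. \<nu>)"
  define U where "U = uniform_count_measure {1..n}"
  define T where "T = (\<lambda>(k, x). (x k :: real, y (rearrange n y x k)))"
  define \<pi> where "\<pi> = distr (U \<Otimes>\<^sub>M P) borel T"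
  have n: "1 \<le> n" using assms by simp
  interpret P: prob_space P
    unfolding P_def by (intro prob_space_PiM) (rule prob_space_axioms)
  interpret U: prob_space U
    unfolding U_def using n by (intro prob_space_uniform_count_measure) auto
  interpret UP: pair_prob_space U P ..
  have [measurable_cong]: "sets U = sets (count_space {1..n})"
    by (simp add: U_def sets_uniform_count_measure_count_space)
  have [measurable_cong]: "sets \<nu> = sets borel" by simp
  have proj: "(fst :: real \<times> real \<Rightarrow> real) \<in> borel_measurable borel"
    "(snd :: real \<times> real \<Rightarrow> real) \<in> borel_measurable borel"
    by (auto intro!: borel_measurable_continuous_onI continuous_intros)
  have coord [measurable]: "(\<lambda>x. x k) \<in> borel_measurable P" if "k \<in> {1..n}" for k
    unfolding P_def using that by (rule measurable_PiM_coordinate) simp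
  have match [measurable]: "(\<lambda>x. y (rearrange n y x k)) \<in> borel_measurable P" if "k \<in> {1..n}" for k
    unfolding P_def using that by (rule measurable_rearrange) simp
  have T [measurable]: "T \<in> borel_measurable (U \<Otimes>\<^sub>M P)"
  proof -
    have "T \<in> borel_measurable (count_space {1..n} \<Otimes>\<^sub>M P)"
      by (rule measurable_pair_measure_countable1)
         (auto simp: T_def borel_prod[symmetric] intro!: measurable_Pair coord match)
    moreover have "sets (U \<Otimes>\<^sub>M P) = sets (count_space {1..n} \<Otimes>\<^sub>M P)"
      by (intro sets_pair_measure_cong) (simp_all add: U_def sets_uniform_count_measure_count_space)
    ultimately show ?thesis
      using measurable_cong_sets[of "U \<Otimes>\<^sub>M P" "count_space {1..n} \<Otimes>\<^sub>M P" borel borel] by blast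
  qed
  have integral_UP: "(\<integral>\<^sup>+ p. f p \<partial>(U \<Otimes>\<^sub>M P)) = (\<Sum>k=1..n. ennreal (1 / n) * (\<integral>\<^sup>+ x. f (k, x) \<partial>P))"
    if "f \<in> borel_measurable (U \<Otimes>\<^sub>M P)" for f
    using nn_integral_uniform_count_measure_pair[of P "{1..n}" f] that P.sigma_finite_measure_axioms
    unfolding U_def by simp
  have integral_T: "(\<integral>\<^sup>+ p. f (T p) \<partial>(U \<Otimes>\<^sub>M P)) = (\<Sum>k=1..n. ennreal (1 / n) * (\<integral>\<^sup>+ x. f (x k, y (rearrange n y x k)) \<partial>P))"
    if "f \<in> borel_measurable borel" for f
    using integral_UP[OF measurable_compose[OF T that]] by (simp add: T_def)
  have inj: "AE x in P. inj_on x {1..n}"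
  proof -
    \<comment> \<open>Finite energy forbids atoms: the kernel is infinite on the diagonal, so the
      diagonal is null and the sample almost surely has distinct coordinates.\<close>
    have "AE p in \<nu> \<Otimes>\<^sub>M \<nu>. (case p of (x, y) \<Rightarrow> kernel x y) \<noteq> \<infinity>"
      using fin by (intro nn_integral_PInf_AE) auto
    then have ae: "AE p in \<nu> \<Otimes>\<^sub>M \<nu>. fst p \<noteq> snd p"
      by eventually_elim (auto simp: kernel_def)
    have "AE x in distr P (\<nu> \<Otimes>\<^sub>M \<nu>) (\<lambda>x. (x i, x j)). fst x \<noteq> snd x" if "(i, j) \<in> offdiag n" for i j
      unfolding P_def using that prob_space_axioms ae
      by (subst distr_PiM_pair) (auto simp: offdiag_def)
    then have "AE x in P. fst (x i, x j) \<noteq> snd (x i, x j)" if "(i, j) \<in> offdiag n" for i j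
      using that coord by (intro AE_distrD[of "\<lambda>x. (x i, x j)" _ "\<nu> \<Otimes>\<^sub>M \<nu>"]) (auto simp: offdiag_def)
    then have "AE x in P. \<forall>p\<in>offdiag n. x (fst p) \<noteq> x (snd p)"
      by (intro AE_finite_allI) auto
    then show ?thesis
    proof eventually_elim
      case (elim x)
      show ?case
      proof (rule inj_onI)
        fix i j assume "i \<in> {1..n}" "j \<in> {1..n}" "x i = x j"
        with bspec[OF elim, of "(i, j)"] show "i = j"
          by (auto simp: offdiag_def)
      qed
    qed
  qed
  have "prob_space \<pi>"
    unfolding \<pi>_def using T by (rule UP.prob_space_distr)
  moreover have "distr \<pi> borel fst = \<nu>"
  proof (rule measure_eqI)
    fix A assume "A \<in> sets (distr \<pi> borel fst)"
    then have A [measurable]: "A \<in> sets borel" by simp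
    have "emeasure (distr \<pi> borel fst) A = (\<integral>\<^sup>+ z. indicator A z \<partial>distr \<pi> borel fst)"
      by simp
    also have "\<dots> = (\<integral>\<^sup>+ p. indicator A (fst p) \<partial>\<pi>)"
      using proj by (intro nn_integral_distr) (auto simp: \<pi>_def)
    also have "\<dots> = (\<integral>\<^sup>+ p. indicator A (fst (T p)) \<partial>(U \<Otimes>\<^sub>M P))"
      unfolding \<pi>_def using T by (rule nn_integral_distr) (use proj in auto)
    also have "\<dots> = (\<Sum>k=1..n. ennreal (1 / n) * (\<integral>\<^sup>+ x. indicator A (x k) \<partial>P))"
      using proj A by (subst integral_T) (auto intro!: measurable_compose[of fst])
    \<comment> \<open>Every coordinate of the sample has law \<open>\<nu>\<close>, hence so does a
      uniformly chosen one.\<close>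
    also have "\<dots> = (\<Sum>k=1..n. ennreal (1 / n) * emeasure \<nu> A)"
    proof (rule sum.cong[OF refl])
      fix k assume k: "k \<in> {1..n}"
      have "(\<integral>\<^sup>+ x. indicator A (x k) \<partial>P) = (\<integral>\<^sup>+ z. indicator A z \<partial>distr P \<nu> (\<lambda>x. x k))"
        using k unfolding P_def by (subst nn_integral_distr) auto
      also have "distr P \<nu> (\<lambda>x. x k) = \<nu>"
        unfolding P_def using k prob_space_axioms by (intro distr_PiM_component) auto
      finally show "ennreal (1 / n) * (\<integral>\<^sup>+ x. indicator A (x k) \<partial>P) = ennreal (1 / n) * emeasure \<nu> A"
        by simp
    qed
    also have "\<dots> = of_nat n * ennreal (1 / n) * emeasure \<nu> A"
      by (simp add: mult.assoc)
    also have "of_nat n * ennreal (1 / n) = 1"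
      using n by (simp add: ennreal_of_nat_eq_real_of_nat flip: ennreal_mult)
    finally show "emeasure (distr \<pi> borel fst) A = emeasure \<nu> A"
      by simp
  qed simp
  moreover have "distr \<pi> borel snd = empirical_measure n y"
  proof (rule measure_eqI)
    fix A assume "A \<in> sets (distr \<pi> borel snd)"
    then have A [measurable]: "A \<in> sets borel" by simp
    have "emeasure (distr \<pi> borel snd) A = (\<integral>\<^sup>+ z. indicator A z \<partial>distr \<pi> borel snd)"
      by simp
    also have "\<dots> = (\<integral>\<^sup>+ p. indicator A (snd p) \<partial>\<pi>)"
      using proj by (intro nn_integral_distr) (auto simp: \<pi>_def)
    also have "\<dots> = (\<integral>\<^sup>+ p. indicator A (snd (T p)) \<partial>(U \<Otimes>\<^sub>M P))"
      unfolding \<pi>_def using T by (rule nn_integral_distr) (use proj in auto)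
    also have "\<dots> = (\<Sum>k=1..n. ennreal (1 / n) * (\<integral>\<^sup>+ x. indicator A (y (rearrange n y x k)) \<partial>P))"
      using proj A by (subst integral_T) (auto intro!: measurable_compose[of snd])
    also have "\<dots> = (\<integral>\<^sup>+ x. (\<Sum>k=1..n. ennreal (1 / n) * indicator A (y (rearrange n y x k))) \<partial>P)"
      by (subst nn_integral_sum) (auto simp: nn_integral_cmult)
    \<comment> \<open>For almost every sample the matching is a permutation, so the sum runs through
      all entries of \<open>y\<close> whatever \<open>x\<close> is.\<close>
    also have "\<dots> = (\<integral>\<^sup>+ x. (\<Sum>k=1..n. ennreal (1 / n) * indicator A (y k)) \<partial>P)"
    proof (rule nn_integral_cong_AE)
      show "AE x in P. (\<Sum>k=1..n. ennreal (1 / n) * indicator A (y (rearrange n y x k)))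
          = (\<Sum>k=1..n. ennreal (1 / n) * indicator A (y k))"
        using inj
      proof eventually_elim
        case (elim x)
        from sum.reindex_bij_betw[OF rearrange_bij[OF elim y]] show ?case .
      qed
    qed
    also have "\<dots> = (\<Sum>k=1..n. emeasure (return borel (y k)) A) * ennreal (1 / n)"
      by (simp add: P.emeasure_space_1 sum_distrib_left mult.commute)
    also have "\<dots> = emeasure (empirical_measure n y) A"
      using n by (simp add: emeasure_empirical_measure divide_ennreal_def inverse_ennreal
          ennreal_of_nat_eq_real_of_nat inverse_eq_divide)
    finally show "emeasure (distr \<pi> borel snd) A = emeasure (empirical_measure n y) A" .
  qed simp
  ultimately have "\<pi> \<in> couplings \<nu> (empirical_measure n y)"
    by (simp add: couplings_def \<pi>_def)
  moreover have "ennreal \<rho> * (\<integral>\<^sup>+ (x, y). ennreal (\<bar>x - y\<bar>\<^sup>2) \<partial>\<pi>) + ennreal (config_energy Q n y + B)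
      \<le> (\<integral>\<^sup>+ (x, y). kernel x y \<partial>(\<nu> \<Otimes>\<^sub>M \<nu>))"
  proof -
    define N where "N = real n * (real n - 1)"
    have N: "N > 0" "real (card (offdiag n)) = N"
      using assms by (simp_all add: N_def card_offdiag)
    have avg: "config_energy Q n u + B = (\<Sum>(i, j)\<in>offdiag n. 1 / N * (pair_energy Q (u i) (u j) + B))" for u
    proof -
      have "(\<Sum>(i, j)\<in>offdiag n. 1 / N * (pair_energy Q (u i) (u j) + B))
          = 1 / N * (\<Sum>(i, j)\<in>offdiag n. pair_energy Q (u i) (u j) + B)"
        by (simp add: case_prod_beta sum_distrib_left)
      also have "\<dots> = 1 / N * ((\<Sum>(i, j)\<in>offdiag n. pair_energy Q (u i) (u j)) + N * B)"
        by (simp add: case_prod_beta sum.distrib N)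
      finally show ?thesis
        using N by (simp add: config_energy_def N_def[symmetric] distrib_left)
    qed
    have cost: "(\<lambda>(x, y). ennreal (\<bar>x - y\<bar>\<^sup>2)) \<in> borel_measurable (borel :: (real \<times> real) measure)"
      unfolding borel_prod[symmetric] by measurable
    have "(\<integral>\<^sup>+ (x, y). ennreal (\<bar>x - y\<bar>\<^sup>2) \<partial>\<pi>)
        = (\<Sum>k=1..n. ennreal (1 / n) * (\<integral>\<^sup>+ x. ennreal ((x k - y (rearrange n y x k))\<^sup>2) \<partial>P))"
      unfolding \<pi>_def using integral_T[OF cost] nn_integral_distr[OF T, of "\<lambda>(x, y). ennreal (\<bar>x - y\<bar>\<^sup>2)"] cost
      by simp
    also have "\<dots> = (\<integral>\<^sup>+ x. (\<Sum>k=1..n. ennreal (1 / n) * ennreal ((x k - y (rearrange n y x k))\<^sup>2)) \<partial>P)"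
      by (subst nn_integral_sum) (auto simp: nn_integral_cmult)
    also have "\<dots> = (\<integral>\<^sup>+ x. ennreal (1 / n * (\<Sum>k=1..n. (x k - y (rearrange n y x k))\<^sup>2)) \<partial>P)"
      by (simp add: sum_distrib_left flip: sum_ennreal ennreal_mult)
    finally have "ennreal \<rho> * (\<integral>\<^sup>+ (x, y). ennreal (\<bar>x - y\<bar>\<^sup>2) \<partial>\<pi>) + ennreal (config_energy Q n y + B)
        = ennreal \<rho> * (\<integral>\<^sup>+ x. ennreal (1 / n * (\<Sum>k=1..n. (x k - y (rearrange n y x k))\<^sup>2)) \<partial>P)
          + (\<integral>\<^sup>+ x. ennreal (config_energy Q n y + B) \<partial>P)"
      by (simp add: P.emeasure_space_1)
    also have "\<dots> = (\<integral>\<^sup>+ x. ennreal \<rho> * ennreal (1 / n * (\<Sum>k=1..n. (x k - y (rearrange n y x k))\<^sup>2))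
          + ennreal (config_energy Q n y + B) \<partial>P)"
      by (subst nn_integral_add) (auto simp: nn_integral_cmult)
    also have "\<dots> \<le> (\<integral>\<^sup>+ x. (\<Sum>(i, j)\<in>offdiag n. ennreal (1 / N) * kernel (x i) (x j)) \<partial>P)"
    proof (rule nn_integral_mono_AE)
      show "AE x in P. ennreal \<rho> * ennreal (1 / n * (\<Sum>k=1..n. (x k - y (rearrange n y x k))\<^sup>2))
            + ennreal (config_energy Q n y + B)
          \<le> (\<Sum>(i, j)\<in>offdiag n. ennreal (1 / N) * kernel (x i) (x j))"
        using inj
      proof eventually_elim
        case (elim x)
        let ?S = "\<Sum>k=1..n. (x k - y (rearrange n y x k))\<^sup>2"
        \<comment> \<open>Without this sign \<open>ennreal\<close> would truncate and addition would
          not transfer from the reals.\<close>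
        have "0 \<le> config_energy Q n y + B"
          unfolding avg using N by (intro sum_nonneg) (auto simp: pair_energy_nonneg)
        then have "ennreal \<rho> * ennreal (1 / n * ?S) + ennreal (config_energy Q n y + B)
            = ennreal (\<rho> / n * ?S + (config_energy Q n y + B))"
          using rho_pos by (simp add: ennreal_plus sum_nonneg flip: ennreal_mult)
        also have "\<dots> \<le> ennreal (config_energy Q n x + B)"
          using config_energy_gap[OF less_imp_le[OF rho_pos] strongly_convex \<open>2 \<le> n\<close> elim y min]
          by (intro ennreal_leI) simp
        also have "\<dots> = (\<Sum>(i, j)\<in>offdiag n. ennreal (1 / N * (pair_energy Q (x i) (x j) + B)))"
          unfolding avg using N by (subst sum_ennreal[symmetric]) (auto simp: case_prod_beta pair_energy_nonneg)
        also have "\<dots> = (\<Sum>(i, j)\<in>offdiag n. ennreal (1 / N) * kernel (x i) (x j))"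
        proof (intro sum.cong refl, clarify)
          fix i j assume "(i, j) \<in> offdiag n"
          then have "x i \<noteq> x j"
            using inj_onD[OF elim, of i j] by (auto simp: offdiag_def)
          then show "ennreal (1 / N * (pair_energy Q (x i) (x j) + B)) = ennreal (1 / N) * kernel (x i) (x j)"
            using N unfolding kernel_def by (subst ennreal_mult) (auto simp: pair_energy_nonneg)
        qed
        finally show ?case .
      qed
    qed
    also have "\<dots> = (\<Sum>(i, j)\<in>offdiag n. ennreal (1 / N) * (\<integral>\<^sup>+ x. kernel (x i) (x j) \<partial>P))"
    proof -
      have [measurable]: "(\<lambda>x. kernel (x i) (x j)) \<in> borel_measurable P" if "(i, j) \<in> offdiag n" for i j
        using that by (auto simp: offdiag_def intro!: measurable_compose[OF measurable_Pair measurable_kernel, simplified] coord)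
      show ?thesis
        unfolding case_prod_beta
        by (subst nn_integral_sum) (auto simp: nn_integral_cmult intro!: sum.cong)
    qed
    \<comment> \<open>All off-diagonal pairs have the same expected kernel, and their weights
      \<open>1 / N\<close> add up to 1.\<close>
    also have "\<dots> = (\<Sum>(i, j)\<in>offdiag n. ennreal (1 / N) * (\<integral>\<^sup>+ (x, y). kernel x y \<partial>(\<nu> \<Otimes>\<^sub>M \<nu>)))"
    proof (intro sum.cong refl, clarify)
      fix i j assume "(i, j) \<in> offdiag n"
      then have ij: "i \<in> {1..n}" "j \<in> {1..n}" "i \<noteq> j"
        by (auto simp: offdiag_def)
      then have "(\<integral>\<^sup>+ x. kernel (x i) (x j) \<partial>P)
          = (\<integral>\<^sup>+ (x, y). kernel x y \<partial>distr P (\<nu> \<Otimes>\<^sub>M \<nu>) (\<lambda>x. (x i, x j)))"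
        unfolding P_def by (subst nn_integral_distr) auto
      also have "distr P (\<nu> \<Otimes>\<^sub>M \<nu>) (\<lambda>x. (x i, x j)) = \<nu> \<Otimes>\<^sub>M \<nu>"
        unfolding P_def using ij by (intro distr_PiM_pair prob_space_axioms)
      finally show "ennreal (1 / N) * (\<integral>\<^sup>+ x. kernel (x i) (x j) \<partial>P)
          = ennreal (1 / N) * (\<integral>\<^sup>+ (x, y). kernel x y \<partial>(\<nu> \<Otimes>\<^sub>M \<nu>))"
        by simp
    qed
    also have "\<dots> = of_nat (card (offdiag n)) * ennreal (1 / N) * (\<integral>\<^sup>+ (x, y). kernel x y \<partial>(\<nu> \<Otimes>\<^sub>M \<nu>))"
      by (simp add: case_prod_beta mult.assoc)
    also have "of_nat (card (offdiag n)) * ennreal (1 / N) = 1"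
      using N by (simp add: ennreal_of_nat_eq_real_of_nat flip: ennreal_mult)
    also have "1 * (\<integral>\<^sup>+ (x, y). kernel x y \<partial>(\<nu> \<Otimes>\<^sub>M \<nu>)) = (\<integral>\<^sup>+ (x, y). kernel x y \<partial>(\<nu> \<Otimes>\<^sub>M \<nu>))"
      by simp
    finally show ?thesis .
  qed
  ultimately show ?thesis
    by (rule that)
qed

text \<open>Infinite energy is harmless because the discrete minimum is finite. Otherwise everything
  is finite, and the shift by \<open>B\<close> cancels in real arithmetic.\<close>

lemma energy_gap:
  assumes "2 \<le> n" "real_distribution \<nu>" "fekete_point Q n y"
  shows "ereal \<rho> * (enn2ereal (W2 \<nu> (empirical_measure n y)))\<^sup>2 \<le> energy Q \<nu> - min_discrete_energy Q n"
proof (cases "(\<integral>\<^sup>+ (x, y). kernel x y \<partial>(\<nu> \<Otimes>\<^sub>M \<nu>)) = \<top>")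
  case True
  then show ?thesis
    using fekete_pointD[OF assms(1,3)] by (simp add: energy_eq[OF assms(2)])
next
  case False
  note y = fekete_pointD[OF assms(1,3)]
  have "config_energy Q n y \<le> config_energy Q n u" if "inj_on u {1..n}" for u
    using min_discrete_energy_le[OF assms(1) that, of Q] y by simp
  from coupling_cost_le[OF assms(2,1) y(1) this False] obtain \<pi> where
    \<pi>: "\<pi> \<in> couplings \<nu> (empirical_measure n y)"
      "ennreal \<rho> * (\<integral>\<^sup>+ (x, y). ennreal (\<bar>x - y\<bar>\<^sup>2) \<partial>\<pi>) + ennreal (config_energy Q n y + B)
        \<le> (\<integral>\<^sup>+ (x, y). kernel x y \<partial>(\<nu> \<Otimes>\<^sub>M \<nu>))"
    by blast
  define K where "K = (\<integral>\<^sup>+ (x, y). kernel x y \<partial>(\<nu> \<Otimes>\<^sub>M \<nu>))"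
  define c where "c = (INF \<pi>\<in>couplings \<nu> (empirical_measure n y). \<integral>\<^sup>+ (x, y). ennreal (\<bar>x - y\<bar>\<^sup>2) \<partial>\<pi>)"
  have "c \<le> (\<integral>\<^sup>+ (x, y). ennreal (\<bar>x - y\<bar>\<^sup>2) \<partial>\<pi>)"
    unfolding c_def using \<pi>(1) by (rule INF_lower)
  then have "ennreal \<rho> * c + ennreal (config_energy Q n y + B) \<le> K"
    using \<pi>(2) unfolding K_def by (meson add_right_mono mult_left_mono order_trans zero_le)
  moreover obtain k where k: "K = ennreal k" "0 \<le> k"
    using False by (cases K) (auto simp: K_def)
  ultimately have *: "ennreal \<rho> * c + ennreal (config_energy Q n y + B) \<le> ennreal k"
    by simp
  \<comment> \<open>An infinite transport cost, multiplied by the positive \<rho>, would exceed the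
    finite energy.\<close>
  moreover obtain d where d: "c = ennreal d" "0 \<le> d"
  proof (cases c)
    case top
    with * rho_pos show ?thesis
      by (simp add: ennreal_mult_top top_unique)
  qed
  ultimately have "ennreal (\<rho> * d) + ennreal (config_energy Q n y + B) \<le> ennreal k"
    using rho_pos by (simp add: ennreal_mult)
  then have "\<rho> * d + (config_energy Q n y + B) \<le> k"
    using rho_pos d k by (cases "0 \<le> config_energy Q n y + B") (auto simp: ennreal_neg simp flip: ennreal_plus)
  moreover have "(enn2ereal (W2 \<nu> (empirical_measure n y)))\<^sup>2 = ereal d"
    using d unfolding W2_def c_def[symmetric] by (simp add: ext_sqrt_def enn2ereal_ennreal)
  moreover have "energy Q \<nu> = ereal (k - B)"
    using k by (simp add: energy_eq[OF assms(2)] K_def[symmetric] enn2ereal_ennreal)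
  ultimately show ?thesis
    by (simp add: y)
qed

end

section \<open>Empirical measures and weak convergence\<close>

text \<open>The law of a uniformly chosen entry; repeated entries are counted with
  multiplicity.\<close>

lemma empirical_measure_eq_distr:
  assumes "1 \<le> n"
  shows "empirical_measure n x = distr (uniform_count_measure {1..n}) borel x"
proof (rule measure_eqI)
  fix A assume "A \<in> sets (empirical_measure n x)"
  then have A: "A \<in> sets borel" by simp
  have "emeasure (distr (uniform_count_measure {1..n}) borel x) A
      = emeasure (uniform_count_measure {1..n}) (x -` A \<inter> {1..n})"
    using A by (subst emeasure_distr) (auto simp: space_uniform_count_measure sets_uniform_count_measure_count_space cong: measurable_cong_sets)
  also have "\<dots> = ennreal (real (card (x -` A \<inter> {1..n})) / real n)"
    by (simp add: emeasure_uniform_count_measure)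
  also have "real (card (x -` A \<inter> {1..n})) = (\<Sum>k=1..n. indicator A (x k))"
    by (simp add: indicator_def sum.If_cases vimage_def Int_commute)
  also have "ennreal ((\<Sum>k=1..n. indicator A (x k)) / real n) = (\<Sum>k=1..n. emeasure (return borel (x k)) A) / of_nat n"
    using A assms by (simp add: divide_ennreal[symmetric] sum_nonneg ennreal_of_nat_eq_real_of_nat ennreal_indicator flip: sum_ennreal)
  finally show "emeasure (empirical_measure n x) A = emeasure (distr (uniform_count_measure {1..n}) borel x) A"
    using A by (simp add: emeasure_empirical_measure)
qed simp

lemma measurable_uniform_count_measure [simp]:
  "x \<in> borel_measurable (uniform_count_measure A)"
  by (simp add: sets_uniform_count_measure_count_space cong: measurable_cong_sets)

lemma nn_integral_empirical_measure:
  assumes "1 \<le> n" "f \<in> borel_measurable borel"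
  shows "(\<integral>\<^sup>+ z. f z \<partial>empirical_measure n x) = (\<Sum>k=1..n. ennreal (1 / n) * f (x k))"
  unfolding empirical_measure_eq_distr[OF assms(1)]
  using assms(2) by (simp add: nn_integral_distr) (simp add: uniform_count_measure_def nn_integral_point_measure_finite)

lemma real_distribution_empirical_measure:
  assumes "1 \<le> n"
  shows "real_distribution (empirical_measure n x)"
proof -
  interpret prob_space "uniform_count_measure {1..n}"
    using assms by (intro prob_space_uniform_count_measure) auto
  show ?thesis
    unfolding empirical_measure_eq_distr[OF assms] by (rule real_distribution_distr) simp
qed

text \<open>Markov's inequality: a mean absolute value of at most \<open>D\<close> leaves mass at
  most \<open>D / R\<close> outside \<open>{- R<..R}\<close>.\<close>

lemma tight_empirical_measure:
  assumes "\<And>k. 1 \<le> N k" "\<And>k. (\<Sum>i=1..N k. \<bar>y k i\<bar>) / N k \<le> D"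
  shows "tight (\<lambda>k. empirical_measure (N k) (y k))"
  unfolding tight_def
proof (intro conjI allI impI)
  show "real_distribution (empirical_measure (N k) (y k))" for k
    by (rule real_distribution_empirical_measure[OF assms(1)])
  fix \<epsilon> :: real assume "0 < \<epsilon>"
  \<comment> \<open>The summand 1 makes \<open>D / R < \<epsilon>\<close> strict and keeps
    \<open>R\<close> positive if \<open>D\<close> is 0.\<close>
  define R where "R = (\<bar>D\<bar> + 1) / \<epsilon>"
  have R: "0 < R" using \<open>0 < \<epsilon>\<close> by (simp add: R_def)
  have "1 - \<epsilon> < measure (empirical_measure (N k) (y k)) {- R<..R}" for k
  proof -
    interpret real_distribution "empirical_measure (N k) (y k)"
      by (rule real_distribution_empirical_measure[OF assms(1)])
    let ?M = "empirical_measure (N k) (y k)" and ?A = "- {- R<..R}"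
    have "emeasure ?M ?A = (\<integral>\<^sup>+ z. indicator ?A z \<partial>?M)"
      by simp
    also have "\<dots> = (\<Sum>i=1..N k. ennreal (1 / N k) * indicator ?A (y k i))"
      using assms(1) by (intro nn_integral_empirical_measure) auto
    also have "\<dots> \<le> (\<Sum>i=1..N k. ennreal (1 / N k * (\<bar>y k i\<bar> / R)))"
    proof (rule sum_mono)
      fix i
      have "indicator ?A (y k i) \<le> ennreal (\<bar>y k i\<bar> / R)"
        using R by (auto simp: indicator_def simp flip: ennreal_1 intro!: ennreal_leI)
      then show "ennreal (1 / N k) * indicator ?A (y k i) \<le> ennreal (1 / N k * (\<bar>y k i\<bar> / R))"
        using R by (subst ennreal_mult) (auto intro!: mult_left_mono)
    qed
    also have "\<dots> = ennreal ((\<Sum>i=1..N k. \<bar>y k i\<bar>) / N k / R)"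
      using R by (subst sum_ennreal) (auto simp: sum_divide_distrib mult.commute)
    also have "\<dots> \<le> ennreal (D / R)"
      using R assms(2) by (intro ennreal_leI divide_right_mono) auto
    finally have "measure ?M ?A \<le> max 0 (D / R)"
      unfolding emeasure_eq_measure ennreal_le_iff2 by auto
    also have "\<dots> < \<epsilon>"
    proof -
      have "D / R < \<epsilon>"
        using R \<open>0 < \<epsilon>\<close> by (simp add: R_def pos_divide_less_eq)
      then show ?thesis using \<open>0 < \<epsilon>\<close> by simp
    qed
    finally show ?thesis
      using prob_compl[of "{- R<..R}"] by (simp add: Compl_eq_Diff_UNIV)
  qed
  then show "\<exists>a b. a < b \<and> (\<forall>k. 1 - \<epsilon> < measure (empirical_measure (N k) (y k)) {a<..b})"
    using R by (intro exI[of _ "- R"] exI[of _ R]) auto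
qed

section \<open>From Wasserstein convergence to weak convergence\<close>

lemma cts_step_lipschitz:
  assumes "a < b"
  shows "\<bar>cts_step a b x - cts_step a b y\<bar> \<le> \<bar>x - y\<bar> / (b - a)"
proof -
  let ?r = "\<lambda>z. (b - z) / (b - a)"
  \<comment> \<open>A clamped affine function: clamping to [0, 1] does not increase
    distances.\<close>
  have "cts_step a b z = max 0 (min 1 (?r z))" for z
    using assms by (auto simp: cts_step_def field_simps max_def min_def)
  then have "\<bar>cts_step a b x - cts_step a b y\<bar> \<le> \<bar>?r x - ?r y\<bar>"
    by simp
  also have "?r x - ?r y = (y - x) / (b - a)"
    by (simp flip: diff_divide_distrib)
  finally show ?thesis
    using assms by (simp add: abs_minus_commute)
qed

text \<open>Young's inequality for \<open>u = d / l\<close>. It takes the place of Cauchy-Schwarz in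
  passing from a first moment to the quadratic cost.\<close>

lemma divide_le_add_square:
  fixes d l e :: real
  assumes "0 \<le> d" "0 < l" "0 < e"
  shows "d / l \<le> e + 1 / (e * l\<^sup>2) * d\<^sup>2"
proof -
  define u where "u = d / l"
  have "0 \<le> (u - e)\<^sup>2 / e"
    using assms by simp
  also have "\<dots> = u\<^sup>2 / e - 2 * u + e"
    using assms by (simp add: field_simps power2_eq_square)
  finally have "u \<le> e + u\<^sup>2 / e"
    using divide_nonneg_pos[OF assms(1,2)] unfolding u_def by linarith
  then show ?thesis
    by (simp add: u_def power_divide mult.commute)
qed

text \<open>Under the coupling the two integrals differ by at most the mean of
  \<open>\<bar>x - y\<bar> / (b - a)\<close>. Young's inequality splits this into \<epsilon> and a
  multiple of the cost, which the bound on the cost makes at most \<epsilon>.\<close>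

lemma cts_step_integral_diff_le:
  assumes "real_distribution \<mu>" "real_distribution \<nu>" "\<pi> \<in> couplings \<mu> \<nu>" "a < b" "0 < \<epsilon>"
    and "(\<integral>\<^sup>+ (x, y). ennreal (\<bar>x - y\<bar>\<^sup>2) \<partial>\<pi>) \<le> ennreal (\<epsilon>\<^sup>2 * (b - a)\<^sup>2)"
  shows "\<bar>integral\<^sup>L \<mu> (cts_step a b) - integral\<^sup>L \<nu> (cts_step a b)\<bar> \<le> 2 * \<epsilon>"
proof -
  interpret \<mu>: real_distribution \<mu> by fact
  interpret \<nu>: real_distribution \<nu> by fact
  interpret prob_space \<pi>
    using assms(3) by (simp add: couplings_def)
  let ?c = "cts_step a b"
  have \<pi>: "sets \<pi> = sets borel" "distr \<pi> borel fst = \<mu>" "distr \<pi> borel snd = \<nu>"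
    using assms(3) by (auto simp: couplings_def)
  have [measurable]: "?c \<in> borel_measurable borel"
    unfolding cts_step_def[abs_def] by measurable
  have [measurable]: "(fst :: real \<times> real \<Rightarrow> real) \<in> borel_measurable \<pi>"
    "(snd :: real \<times> real \<Rightarrow> real) \<in> borel_measurable \<pi>"
    using \<pi>(1) by (auto simp: borel_prod[symmetric] cong: measurable_cong_sets)
  have bound: "\<bar>?c z\<bar> \<le> 1" for z
    using assms(4) by (auto simp: cts_step_def field_simps)
  have int: "integrable \<pi> (\<lambda>p. ?c (fst p))" "integrable \<pi> (\<lambda>p. ?c (snd p))"
    by (rule integrable_const_bound[where B = 1]; simp add: bound)+
  have "\<bar>integral\<^sup>L \<mu> ?c - integral\<^sup>L \<nu> ?c\<bar> = \<bar>\<integral>p. ?c (fst p) - ?c (snd p) \<partial>\<pi>\<bar>"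
    using int unfolding \<pi>(2,3)[symmetric] by (simp add: integral_distr)
  also have "\<dots> \<le> (\<integral>p. \<bar>?c (fst p) - ?c (snd p)\<bar> \<partial>\<pi>)"
    by (rule integral_abs_bound)
  finally have "ennreal \<bar>integral\<^sup>L \<mu> ?c - integral\<^sup>L \<nu> ?c\<bar> \<le> ennreal (\<integral>p. \<bar>?c (fst p) - ?c (snd p)\<bar> \<partial>\<pi>)"
    by (rule ennreal_leI)
  also have "\<dots> = (\<integral>\<^sup>+ p. ennreal \<bar>?c (fst p) - ?c (snd p)\<bar> \<partial>\<pi>)"
    using int by (intro nn_integral_eq_integral[symmetric]) auto
  also have "\<dots> \<le> (\<integral>\<^sup>+ p. ennreal \<epsilon> + ennreal (1 / (\<epsilon> * (b - a)\<^sup>2)) * (case p of (x, y) \<Rightarrow> ennreal (\<bar>x - y\<bar>\<^sup>2)) \<partial>\<pi>)"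
  proof (intro nn_integral_mono)
    fix p :: "real \<times> real"
    let ?d = "\<bar>fst p - snd p\<bar>" and ?l = "b - a"
    have "?d / ?l \<le> \<epsilon> + 1 / (\<epsilon> * ?l\<^sup>2) * ?d\<^sup>2"
      using assms by (intro divide_le_add_square) auto
    with cts_step_lipschitz[OF assms(4), of "fst p" "snd p"]
    have "\<bar>?c (fst p) - ?c (snd p)\<bar> \<le> \<epsilon> + 1 / (\<epsilon> * ?l\<^sup>2) * ?d\<^sup>2"
      by linarith
    then have "ennreal \<bar>?c (fst p) - ?c (snd p)\<bar> \<le> ennreal (\<epsilon> + 1 / (\<epsilon> * ?l\<^sup>2) * ?d\<^sup>2)"
      by (rule ennreal_leI)
    then show "ennreal \<bar>?c (fst p) - ?c (snd p)\<bar>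
        \<le> ennreal \<epsilon> + ennreal (1 / (\<epsilon> * ?l\<^sup>2)) * (case p of (x, y) \<Rightarrow> ennreal (\<bar>x - y\<bar>\<^sup>2))"
      using assms by (simp add: case_prod_beta flip: ennreal_mult ennreal_plus)
  qed
  also have "\<dots> = ennreal \<epsilon> + ennreal (1 / (\<epsilon> * (b - a)\<^sup>2)) * (\<integral>\<^sup>+ (x, y). ennreal (\<bar>x - y\<bar>\<^sup>2) \<partial>\<pi>)"
    unfolding case_prod_beta by (subst nn_integral_add) (auto simp: nn_integral_cmult emeasure_space_1)
  also have "\<dots> \<le> ennreal \<epsilon> + ennreal (1 / (\<epsilon> * (b - a)\<^sup>2)) * ennreal (\<epsilon>\<^sup>2 * (b - a)\<^sup>2)"
    using assms(6) by (intro add_left_mono mult_left_mono) auto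
  also have "\<dots> = ennreal (\<epsilon> + 1 / (\<epsilon> * (b - a)\<^sup>2) * (\<epsilon>\<^sup>2 * (b - a)\<^sup>2))"
    using assms by (simp flip: ennreal_mult ennreal_plus)
  also have "\<epsilon> + 1 / (\<epsilon> * (b - a)\<^sup>2) * (\<epsilon>\<^sup>2 * (b - a)\<^sup>2) = 2 * \<epsilon>"
    using assms by (simp add: power2_eq_square)
  finally show ?thesis
    using assms by simp
qed

text \<open>The strict inequality yields an almost optimal coupling without any claim that the
  infimum is attained.\<close>

lemma W2_lessD:
  assumes "W2 \<mu> \<nu> < ennreal e" "0 \<le> e"
  obtains \<pi> where "\<pi> \<in> couplings \<mu> \<nu>" "(\<integral>\<^sup>+ (x, y). ennreal (\<bar>x - y\<bar>\<^sup>2) \<partial>\<pi>) \<le> ennreal (e\<^sup>2)"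
proof -
  define c where "c = (INF \<pi>\<in>couplings \<mu> \<nu>. \<integral>\<^sup>+ (x, y). ennreal (\<bar>x - y\<bar>\<^sup>2) \<partial>\<pi>)"
  have "ext_sqrt c < ennreal e"
    using assms unfolding W2_def c_def by simp
  then obtain d where d: "c = ennreal d" "0 \<le> d" "sqrt d < e"
    using assms(2) by (cases c) (auto simp: ext_sqrt_def ennreal_less_iff)
  then have "d < e\<^sup>2"
    using real_less_rsqrt by (metis assms(2) real_sqrt_less_iff real_sqrt_unique)
  then have "c < ennreal (e\<^sup>2)"
    using d by (simp add: ennreal_less_iff)
  then show ?thesis
    using that unfolding c_def INF_less_iff by (blast intro: less_imp_le)
qed

lemma weak_conv_of_W2:
  assumes "real_distribution \<mu>" "\<And>n. real_distribution (M n)" "(\<lambda>n. W2 \<mu> (M n)) \<longlonglongrightarrow> 0"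
  shows "weak_conv_m M \<mu>"
proof (rule integral_cts_step_conv_imp_weak_conv[OF assms(2,1)])
  fix a b :: real assume "a < b"
  show "(\<lambda>n. integral\<^sup>L (M n) (cts_step a b)) \<longlonglongrightarrow> integral\<^sup>L \<mu> (cts_step a b)"
  proof (rule tendstoI)
    fix e :: real assume "0 < e"
    define \<epsilon> where "\<epsilon> = e / 3"
    have \<epsilon>: "0 < \<epsilon>" "2 * \<epsilon> < e" using \<open>0 < e\<close> by (auto simp: \<epsilon>_def)
    have "\<forall>\<^sub>F n in sequentially. W2 \<mu> (M n) < ennreal (\<epsilon> * (b - a))"
      using assms(3) \<epsilon> \<open>a < b\<close> by (intro order_tendstoD(2)) auto
    then show "\<forall>\<^sub>F n in sequentially. dist (integral\<^sup>L (M n) (cts_step a b)) (integral\<^sup>L \<mu> (cts_step a b)) < e"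
    proof eventually_elim
      case (elim n)
      then obtain \<pi> where "\<pi> \<in> couplings \<mu> (M n)"
          "(\<integral>\<^sup>+ (x, y). ennreal (\<bar>x - y\<bar>\<^sup>2) \<partial>\<pi>) \<le> ennreal ((\<epsilon> * (b - a))\<^sup>2)"
        using W2_lessD[of \<mu> "M n" "\<epsilon> * (b - a)"] \<epsilon> \<open>a < b\<close> by auto
      then have "\<bar>integral\<^sup>L \<mu> (cts_step a b) - integral\<^sup>L (M n) (cts_step a b)\<bar> \<le> 2 * \<epsilon>"
        using \<epsilon> \<open>a < b\<close> by (intro cts_step_integral_diff_le[OF assms(1,2)]) (auto simp: power_mult_distrib)
      then show ?case
        using \<epsilon> by (simp add: dist_real_def abs_minus_commute)
    qed
  qed
qed

section \<open>Finiteness of the minimal energy\<close>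

text \<open>Discrete layer-cake bound: for \<open>a \<ge> 0\<close> the sum counts the naturals up
  to \<open>a\<close>, of which there are \<open>\<lfloor>a\<rfloor> + 1\<close>.\<close>

lemma ennreal_le_suminf_indicator:
  "ennreal a \<le> (\<Sum>k. if real k \<le> a then 1 else 0)"
proof (cases "0 \<le> a")
  case True
  have "ennreal a \<le> ennreal (real (Suc (nat \<lfloor>a\<rfloor>)))"
    by (intro ennreal_leI) linarith
  also have "\<dots> = (\<Sum>k<Suc (nat \<lfloor>a\<rfloor>). if real k \<le> a then 1 else 0)"
  proof -
    have "real k \<le> a" if "k < Suc (nat \<lfloor>a\<rfloor>)" for k
      using that True by linarith
    then have "(\<Sum>k<Suc (nat \<lfloor>a\<rfloor>). if real k \<le> a then 1 else 0) = (\<Sum>k<Suc (nat \<lfloor>a\<rfloor>). 1 :: ennreal)"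
      by (intro sum.cong) auto
    also have "\<dots> = ennreal (real (Suc (nat \<lfloor>a\<rfloor>)))"
      by (simp add: ennreal_of_nat_eq_real_of_nat del: of_nat_Suc)
    finally show ?thesis ..
  qed
  also have "\<dots> \<le> (\<Sum>k. if real k \<le> a then 1 else 0)"
    by (rule sum_le_suminf) auto
  finally show ?thesis .
qed (simp add: ennreal_neg)

text \<open>The layers of the logarithmic singularity are intervals of radius exp(-k), whose lengths
  are summable; no explicit integral of \<open>ln\<close> has to be computed.\<close>

lemma neg_ln_le_suminf:
  assumes "x \<noteq> y"
  shows "ennreal (- ln \<bar>x - y\<bar>) \<le> (\<Sum>k. indicator {x - exp (- real k)..x + exp (- real k)} y)"
proof -
  have "real k \<le> - ln \<bar>x - y\<bar> \<longleftrightarrow> y \<in> {x - exp (- real k)..x + exp (- real k)}" for k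
  proof -
    have "real k \<le> - ln \<bar>x - y\<bar> \<longleftrightarrow> ln \<bar>x - y\<bar> \<le> ln (exp (- real k))"
      by auto
    also have "\<dots> \<longleftrightarrow> \<bar>x - y\<bar> \<le> exp (- real k)"
      using assms by (subst ln_le_cancel_iff) auto
    finally show ?thesis by auto
  qed
  then show ?thesis
    using ennreal_le_suminf_indicator[of "- ln \<bar>x - y\<bar>"] by (simp add: indicator_def of_bool_def)
qed

lemma ennreal_add_le:
  assumes "0 \<le> a"
  shows "ennreal (a + b) \<le> ennreal a + ennreal b"
proof (cases "0 \<le> b")
  case False
  then have "ennreal (a + b) \<le> ennreal a"
    by (intro ennreal_leI) simp
  then show ?thesis
    using False by (simp add: ennreal_neg)
qed (use assms in simp)

context external_field
begin

text \<open>The uniform measure on [0, 1] works: \<open>Q\<close> is bounded on this compact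
  interval, and the density is at most 1, so the layers around each \<open>x\<close> have masses
  dominated by a geometric series.\<close>

lemma finite_energy_measure:
  obtains \<nu> where "real_distribution \<nu>" "energy Q \<nu> < \<infinity>"
proof -
  define \<nu> where "\<nu> = uniform_measure lborel {0..1 :: real}"
  have "real_distribution \<nu>"
    unfolding \<nu>_def real_distribution_def real_distribution_axioms_def
    by (auto intro!: prob_space_uniform_measure)
  then interpret real_distribution \<nu> .
  have [measurable_cong]: "sets \<nu> = sets borel" by simp
  have AE01: "AE x in \<nu>. x \<in> {0..1}"
    unfolding \<nu>_def by (rule AE_uniform_measureI) auto
  have AE_neq: "AE y in \<nu>. x \<noteq> y" for x
    unfolding \<nu>_def using AE_lborel_singleton[of x] by (intro AE_uniform_measureI) auto
  have le: "emeasure \<nu> A \<le> emeasure lborel A" if "A \<in> sets borel" for A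
    unfolding \<nu>_def using that by (simp add: emeasure_mono divide_ennreal_def)
  have "compact (Q ` {0..1})"
    using continuous_on_subset[OF continuous_on_Q] by (intro compact_continuous_image) auto
  then obtain C where C: "\<And>x. x \<in> {0..1} \<Longrightarrow> Q x \<le> C"
    using compact_imp_bounded bounded_imp_bdd_above unfolding bdd_above_def by (metis image_eqI)
  let ?I = "\<lambda>x k. {x - exp (- real k)..x + exp (- real k)}"
  have "(\<integral>\<^sup>+ y. kernel x y \<partial>\<nu>) \<le> ennreal (C + B) + (\<Sum>k. ennreal (2 * exp (-1) ^ k))" if "x \<in> {0..1}" for x
  proof -
    have "(\<integral>\<^sup>+ y. kernel x y \<partial>\<nu>) \<le> (\<integral>\<^sup>+ y. ennreal (C + B) + (\<Sum>k. indicator (?I x k) y) \<partial>\<nu>)"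
    proof (rule nn_integral_mono_AE)
      show "AE y in \<nu>. kernel x y \<le> ennreal (C + B) + (\<Sum>k. indicator (?I x k) y)"
        using AE01 AE_neq[of x]
      proof eventually_elim
        case (elim y)
        have "0 \<le> C + B"
          using C[of x] that coercive[of x] by simp
        have "kernel x y \<le> ennreal ((C + B) + (- ln \<bar>x - y\<bar>))"
          using C[of x] C[of y] elim that by (auto simp: kernel_def pair_energy_def intro!: ennreal_leI)
        also have "\<dots> \<le> ennreal (C + B) + ennreal (- ln \<bar>x - y\<bar>)"
          using \<open>0 \<le> C + B\<close> by (rule ennreal_add_le)
        also have "\<dots> \<le> ennreal (C + B) + (\<Sum>k. indicator (?I x k) y)"
          by (intro add_left_mono neg_ln_le_suminf elim)
        finally show ?case .
      qed
    qed
    also have "\<dots> = ennreal (C + B) + (\<Sum>k. emeasure \<nu> (?I x k))"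
      by (subst nn_integral_add) (auto simp: nn_integral_suminf emeasure_space_1[simplified])
    also have "\<dots> \<le> ennreal (C + B) + (\<Sum>k. ennreal (2 * exp (-1) ^ k))"
    proof (intro add_left_mono suminf_le)
      fix k
      have "emeasure \<nu> (?I x k) \<le> emeasure lborel (?I x k)"
        by (rule le) simp
      then show "emeasure \<nu> (?I x k) \<le> ennreal (2 * exp (-1) ^ k)"
        by (simp flip: exp_of_nat_mult)
    qed auto
    finally show ?thesis .
  qed
  then have "AE x in \<nu>. (\<integral>\<^sup>+ y. kernel x y \<partial>\<nu>) \<le> ennreal (C + B) + (\<Sum>k. ennreal (2 * exp (-1) ^ k))"
    using AE01 by auto
  then have "(\<integral>\<^sup>+ x. \<integral>\<^sup>+ y. kernel x y \<partial>\<nu> \<partial>\<nu>)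
      \<le> (\<integral>\<^sup>+ x. ennreal (C + B) + (\<Sum>k. ennreal (2 * exp (-1) ^ k)) \<partial>\<nu>)"
    by (rule nn_integral_mono_AE)
  also have "\<dots> = ennreal (C + B) + (\<Sum>k. ennreal (2 * exp (-1) ^ k))"
    by (simp add: emeasure_space_1[simplified])
  also have "(\<Sum>k. ennreal (2 * exp (-1) ^ k)) = ennreal (\<Sum>k. 2 * exp (-1) ^ k)"
    by (intro suminf_ennreal2 summable_mult summable_geometric) auto
  also have "ennreal (C + B) + \<dots> < \<infinity>"
    by simp
  finally have "(\<integral>\<^sup>+ x. \<integral>\<^sup>+ y. kernel x y \<partial>\<nu> \<partial>\<nu>) < \<infinity>" .
  moreover have "(\<integral>\<^sup>+ (x, y). kernel x y \<partial>(\<nu> \<Otimes>\<^sub>M \<nu>)) = (\<integral>\<^sup>+ x. \<integral>\<^sup>+ y. kernel x y \<partial>\<nu> \<partial>\<nu>)"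
    by (subst nn_integral_fst[symmetric]) auto
  moreover have "enn2ereal K - ereal B < \<infinity>" if "K < \<infinity>" for K
    using that by (cases K) (auto simp: enn2ereal_ennreal)
  ultimately have "energy Q \<nu> < \<infinity>"
    using energy_eq[OF \<open>real_distribution \<nu>\<close>] by metis
  with \<open>real_distribution \<nu>\<close> show ?thesis
    by (rule that)
qed

section \<open>Lower semicontinuity of the energy\<close>

text \<open>Unlike \<open>kernel\<close>, it is finite on the diagonal, so it can be integrated
  against the square of an empirical measure, which always charges the diagonal.\<close>

definition truncated_kernel :: "real \<Rightarrow> real \<Rightarrow> real \<Rightarrow> real" where
  "truncated_kernel \<delta> x y = (Q x + Q y) / 2 - ln (max \<bar>x - y\<bar> \<delta>) + B"

lemma truncated_kernel_nonneg:
  assumes "0 < \<delta>" "\<delta> \<le> 1"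
  shows "0 \<le> truncated_kernel \<delta> x y"
proof -
  \<comment> \<open>For \<delta> at most 1 the truncated part of the logarithm is nonpositive, so
    \<open>B\<close> still suffices.\<close>
  have "ln (max \<bar>x - y\<bar> \<delta>) \<le> \<bar>x - y\<bar>"
  proof (cases "\<bar>x - y\<bar> \<le> \<delta>")
    case True
    then have "ln (max \<bar>x - y\<bar> \<delta>) \<le> 0"
      using assms by (simp add: max_def)
    then show ?thesis by linarith
  next
    case False
    then show ?thesis
      using ln_abs_le[of x y] by (simp add: max_def)
  qed
  from pair_energy_ge[OF this] show ?thesis
    using coercive[of x] coercive[of y] unfolding truncated_kernel_def by argo
qed

lemma truncated_kernel_le:
  assumes "x \<noteq> y"
  shows "truncated_kernel \<delta> x y \<le> pair_energy Q x y + B"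
  using assms unfolding truncated_kernel_def pair_energy_def by (simp add: ln_mono)

lemma measurable_truncated_kernel [measurable]:
  "(\<lambda>(x, y). truncated_kernel \<delta> x y) \<in> borel_measurable (borel \<Otimes>\<^sub>M borel)"
  unfolding truncated_kernel_def by measurable

lemma truncated_kernel_tendsto:
  assumes "u \<longlonglongrightarrow> x" "v \<longlonglongrightarrow> y" "\<delta> \<longlonglongrightarrow> 0" "\<And>k. 0 < \<delta> k"
  shows "(\<lambda>k. ennreal (truncated_kernel (\<delta> k) (u k) (v k))) \<longlonglongrightarrow> kernel x y"
proof -
  have m: "(\<lambda>k. max \<bar>u k - v k\<bar> (\<delta> k)) \<longlonglongrightarrow> \<bar>x - y\<bar>"
    using tendsto_max[OF tendsto_rabs[OF tendsto_diff[OF assms(1,2)]] assms(3)] by simp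
  have Q: "(\<lambda>k. (Q (u k) + Q (v k)) / 2) \<longlonglongrightarrow> (Q x + Q y) / 2"
    using continuous_on_tendsto_compose[OF continuous_on_Q assms(1)]
      continuous_on_tendsto_compose[OF continuous_on_Q assms(2)]
    by (intro tendsto_intros) auto
  show ?thesis
  proof (cases "x = y")
    case False
    then have "(\<lambda>k. truncated_kernel (\<delta> k) (u k) (v k)) \<longlonglongrightarrow> pair_energy Q x y + B"
      unfolding truncated_kernel_def pair_energy_def by (intro tendsto_intros Q m) auto
    then show ?thesis
      using False by (simp add: kernel_def tendsto_ennrealI)
  next
    case True
    \<comment> \<open>Positivity of \<delta> matters when \<open>u k = v k\<close>: there
      \<open>ln 0 = 0\<close> would break the divergence of the logarithm.\<close>
    have "0 < max \<bar>u k - v k\<bar> (\<delta> k)" for k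
      using assms(4)[of k] by (simp add: less_max_iff_disj)
    then have "filterlim (\<lambda>k. max \<bar>u k - v k\<bar> (\<delta> k)) (at_right 0) sequentially"
      using m True by (intro tendsto_imp_filterlim_at_right always_eventually allI) auto
    then have "filterlim (\<lambda>k. ln (max \<bar>u k - v k\<bar> (\<delta> k))) at_bot sequentially"
      by (rule filterlim_compose[OF ln_at_0])
    then have "filterlim (\<lambda>k. - ln (max \<bar>u k - v k\<bar> (\<delta> k))) at_top sequentially"
      by (simp add: filterlim_uminus_at_top)
    then have "filterlim (\<lambda>k. ((Q (u k) + Q (v k)) / 2 + B) + - ln (max \<bar>u k - v k\<bar> (\<delta> k))) at_top sequentially"
      by (intro filterlim_tendsto_add_at_top[OF tendsto_add[OF Q tendsto_const]])
    then have "filterlim (\<lambda>k. truncated_kernel (\<delta> k) (u k) (v k)) at_top sequentially"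
      by (simp add: truncated_kernel_def algebra_simps)
    then show ?thesis
      using True by (simp add: kernel_def ennreal_tendsto_top_eq_at_top)
  qed
qed

text \<open>Averages over pairs the half of \<open>Q\<close> that \<open>pair_energy_ge'\<close>
  leaves after paying for the logarithm.\<close>

lemma mean_Q_le:
  assumes "2 \<le> n" "config_energy Q n y \<le> c"
  shows "(\<Sum>i=1..n. Q (y i)) / n \<le> 2 * c + B"
proof -
  define N where "N = real n * (real n - 1)"
  have N: "N > 0" "real (card (offdiag n)) = N"
    using assms by (simp_all add: N_def card_offdiag)
  have "(\<Sum>(i, j)\<in>offdiag n. (Q (y i) + Q (y j)) / 4 - B / 2) \<le> (\<Sum>(i, j)\<in>offdiag n. pair_energy Q (y i) (y j))"
    by (intro sum_mono) (auto simp: pair_energy_ge')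
  also have "\<dots> = N * config_energy Q n y"
    using N(1) unfolding config_energy_def N_def[symmetric] by simp
  also have "(\<Sum>(i, j)\<in>offdiag n. (Q (y i) + Q (y j)) / 4 - B / 2)
      = ((\<Sum>(i, j)\<in>offdiag n. Q (y i)) + (\<Sum>(i, j)\<in>offdiag n. Q (y j))) / 4 - N * (B / 2)"
    using N(2) by (simp add: case_prod_beta sum_subtractf sum.distrib flip: sum_divide_distrib)
  also have "(\<Sum>(i, j)\<in>offdiag n. Q (y j)) = (\<Sum>(i, j)\<in>offdiag n. Q (y i))"
    by (rule sum_offdiag_swap)
  also have "(\<Sum>(i, j)\<in>offdiag n. Q (y i)) = N * ((\<Sum>i=1..n. Q (y i)) / n)"
    using assms by (simp add: sum_offdiag_fst of_nat_diff N_def)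
  finally have "N * ((\<Sum>i=1..n. Q (y i)) / n / 2 - B / 2) \<le> N * config_energy Q n y"
    by (simp add: algebra_simps)
  then show ?thesis
    using N(1) assms(2) by simp
qed

lemma mean_abs_le:
  assumes "2 \<le> n" "config_energy Q n y \<le> c"
  shows "(\<Sum>i=1..n. \<bar>y i\<bar>) / n \<le> (2 * c + 2 * B) / 4"
proof -
  have "(\<Sum>i=1..n. \<bar>y i\<bar>) \<le> (\<Sum>i=1..n. (Q (y i) + B) / 4)"
  proof (rule sum_mono)
    fix i show "\<bar>y i\<bar> \<le> (Q (y i) + B) / 4"
      using coercive[of "y i"] by (simp add: field_simps)
  qed
  also have "\<dots> = ((\<Sum>i=1..n. Q (y i)) + n * B) / 4"
    by (simp add: sum.distrib flip: sum_divide_distrib)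
  finally have "(\<Sum>i=1..n. \<bar>y i\<bar>) / n \<le> ((\<Sum>i=1..n. Q (y i)) + n * B) / 4 / n"
    by (rule divide_right_mono) simp
  also have "\<dots> = ((\<Sum>i=1..n. Q (y i)) / n + B) / 4"
    using assms by (simp add: field_simps)
  also have "\<dots> \<le> ((2 * c + B) + B) / 4"
    by (intro divide_right_mono add_right_mono mean_Q_le[OF assms]) simp
  finally show ?thesis
    by (simp add: algebra_simps)
qed

text \<open>Off the diagonal truncation only lowers the kernel, giving at most \<open>c + B\<close>
  per pair. The \<open>n\<close> diagonal terms \<open>Q (y i) + ln n + B\<close> have total size of
  order \<open>n * ln n\<close>, negligible against \<open>n^2\<close>.\<close>

lemma mean_truncated_kernel_le:
  assumes n: "2 \<le> n" and inj: "inj_on y {1..n}" and c: "config_energy Q n y \<le> c"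
  shows "(\<Sum>i=1..n. \<Sum>j=1..n. truncated_kernel (1 / n) (y i) (y j)) / (real n)\<^sup>2
    \<le> c + B + (2 * c + 2 * B + ln n) / n"
proof -
  let ?F = "\<lambda>i j. truncated_kernel (1 / n) (y i) (y j)"
  define N where "N = real n * (real n - 1)"
  have N: "N > 0" "real (card (offdiag n)) = N" "N \<le> (real n)\<^sup>2"
    using n by (simp_all add: N_def card_offdiag power2_eq_square)
  have "{1..n} \<times> {1..n} = offdiag n \<union> (\<lambda>i. (i, i)) ` {1..n}"
    by (auto simp: offdiag_def)
  then have "(\<Sum>(i, j)\<in>{1..n} \<times> {1..n}. ?F i j) = (\<Sum>(i, j)\<in>offdiag n. ?F i j) + (\<Sum>(i, j)\<in>(\<lambda>i. (i, i)) ` {1..n}. ?F i j)"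
    by (simp only:) (rule sum.union_disjoint[OF finite_offdiag]; auto simp: offdiag_def)
  also have "(\<Sum>(i, j)\<in>(\<lambda>i. (i, i)) ` {1..n}. ?F i j) = (\<Sum>i=1..n. ?F i i)"
    by (subst sum.reindex) (auto simp: inj_on_def)
  also have "\<dots> = (\<Sum>i=1..n. Q (y i) + ln n + B)"
    using n by (simp add: truncated_kernel_def ln_div)
  also have "\<dots> = n * ((\<Sum>i=1..n. Q (y i)) / n + ln n + B)"
    using n by (simp add: sum.distrib field_simps)
  also have "\<dots> \<le> n * (2 * c + 2 * B + ln n)"
    using mean_Q_le[OF n c] by (intro mult_left_mono) auto
  also have "(\<Sum>(i, j)\<in>offdiag n. ?F i j) \<le> (\<Sum>(i, j)\<in>offdiag n. pair_energy Q (y i) (y j) + B)"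
  proof (rule sum_mono, clarify)
    fix i j assume "(i, j) \<in> offdiag n"
    then show "?F i j \<le> pair_energy Q (y i) (y j) + B"
      using inj_onD[OF inj, of i j] by (intro truncated_kernel_le) (auto simp: offdiag_def)
  qed
  also have pos: "(\<Sum>(i, j)\<in>offdiag n. pair_energy Q (y i) (y j) + B) = N * (config_energy Q n y + B)"
    using N unfolding config_energy_def N_def[symmetric] by (simp add: case_prod_beta sum.distrib distrib_left)
  \<comment> \<open>Enlarging \<open>N\<close> to \<open>n^2\<close> is allowed because the shifted
    energy is nonnegative.\<close>
  also have "\<dots> \<le> (real n)\<^sup>2 * (c + B)"
  proof (rule mult_mono)
    have "0 \<le> N * (config_energy Q n y + B)"
      unfolding pos[symmetric] by (intro sum_nonneg) (auto simp: pair_energy_nonneg)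
    then show "0 \<le> config_energy Q n y + B"
      using N by (simp add: zero_le_mult_iff)
  qed (use N c in auto)
  finally have "(\<Sum>(i, j)\<in>{1..n} \<times> {1..n}. ?F i j) \<le> (real n)\<^sup>2 * (c + B) + n * (2 * c + 2 * B + ln n)"
    by simp
  then have "(\<Sum>i=1..n. \<Sum>j=1..n. ?F i j) / (real n)\<^sup>2 \<le> ((real n)\<^sup>2 * (c + B) + n * (2 * c + 2 * B + ln n)) / (real n)\<^sup>2"
    by (intro divide_right_mono) (simp_all add: sum.cartesian_product)
  also have "\<dots> = c + B + (2 * c + 2 * B + ln n) / n"
    using n by (simp add: add_divide_distrib power2_eq_square)
  finally show ?thesis .
qed

lemma nn_integral_truncated_kernel_empirical_le:
  assumes n: "2 \<le> n" and "inj_on y {1..n}" and "config_energy Q n y \<le> c"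
  shows "(\<integral>\<^sup>+ (x, x'). ennreal (truncated_kernel (1 / n) x x') \<partial>(empirical_measure n y \<Otimes>\<^sub>M empirical_measure n y))
    \<le> ennreal (c + B + (2 * c + 2 * B + ln n) / n)"
proof -
  let ?M = "empirical_measure n y" and ?F = "truncated_kernel (1 / n)"
  have n1: "1 \<le> n" using n by simp
  interpret real_distribution ?M
    using n1 by (rule real_distribution_empirical_measure)
  have [measurable_cong]: "sets ?M = sets borel" by simp
  have nonneg: "0 \<le> ?F x x'" for x x'
    using n by (intro truncated_kernel_nonneg) auto
  have "(\<integral>\<^sup>+ (x, x'). ennreal (?F x x') \<partial>(?M \<Otimes>\<^sub>M ?M)) = (\<integral>\<^sup>+ x. \<integral>\<^sup>+ x'. ennreal (?F x x') \<partial>?M \<partial>?M)"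
    by (subst nn_integral_fst[symmetric]) auto
  also have "\<dots> = (\<Sum>i=1..n. ennreal (1 / n) * (\<integral>\<^sup>+ x'. ennreal (?F (y i) x') \<partial>?M))"
    by (intro nn_integral_empirical_measure n1) measurable
  also have "\<dots> = (\<Sum>i=1..n. ennreal (1 / n) * (\<Sum>j=1..n. ennreal (1 / n) * ennreal (?F (y i) (y j))))"
    by (intro sum.cong arg_cong2[where f = "(*)"] refl nn_integral_empirical_measure n1) measurable
  also have "\<dots> = ennreal (\<Sum>i=1..n. 1 / n * (\<Sum>j=1..n. 1 / n * ?F (y i) (y j)))"
  proof (subst sum_ennreal[symmetric])
    have "ennreal (1 / n * (\<Sum>j=1..n. 1 / n * ?F (y i) (y j)))
        = ennreal (1 / n) * (\<Sum>j=1..n. ennreal (1 / n) * ennreal (?F (y i) (y j)))" for i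
    proof -
      have "ennreal (1 / n * (\<Sum>j=1..n. 1 / n * ?F (y i) (y j)))
          = ennreal (1 / n) * ennreal (\<Sum>j=1..n. 1 / n * ?F (y i) (y j))"
        by (intro ennreal_mult sum_nonneg mult_nonneg_nonneg nonneg) simp_all
      also have "ennreal (\<Sum>j=1..n. 1 / n * ?F (y i) (y j)) = (\<Sum>j=1..n. ennreal (1 / n * ?F (y i) (y j)))"
        by (intro sum_ennreal[symmetric] mult_nonneg_nonneg nonneg) simp
      also have "\<dots> = (\<Sum>j=1..n. ennreal (1 / n) * ennreal (?F (y i) (y j)))"
        by (intro sum.cong refl ennreal_mult nonneg) simp
      finally show ?thesis .
    qed
    then show "(\<Sum>i=1..n. ennreal (1 / n) * (\<Sum>j=1..n. ennreal (1 / n) * ennreal (?F (y i) (y j))))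
        = (\<Sum>i=1..n. ennreal (1 / n * (\<Sum>j=1..n. 1 / n * ?F (y i) (y j))))"
      by metis
  qed (intro sum_nonneg mult_nonneg_nonneg nonneg; simp)
  also have "(\<Sum>i=1..n. 1 / n * (\<Sum>j=1..n. 1 / n * ?F (y i) (y j))) = (\<Sum>i=1..n. \<Sum>j=1..n. ?F (y i) (y j)) / (real n)\<^sup>2"
    by (simp add: power2_eq_square flip: sum_divide_distrib)
  finally show ?thesis
    using mean_truncated_kernel_le[OF assms] by (simp add: ennreal_leI)
qed

text \<open>Skorohod's theorem turns weak convergence into pointwise convergence, after which
  Fatou's lemma handles a kernel that is unbounded and infinite on the diagonal.\<close>

lemma limit_energy:
  fixes N :: "nat \<Rightarrow> nat"
  assumes N: "\<And>k. 2 \<le> N k" "filterlim N at_top sequentially"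
    and inj: "\<And>k. inj_on (y k) {1..N k}" and c: "\<And>k. config_energy Q (N k) (y k) \<le> c"
  obtains \<mu> where "real_distribution \<mu>" "energy Q \<mu> \<le> ereal c"
proof -
  define M where "M = (\<lambda>k. empirical_measure (N k) (y k))"
  have N1: "1 \<le> N k" for k
    using N(1)[of k] by simp
  have M: "real_distribution (M k)" for k
    unfolding M_def using N1 by (rule real_distribution_empirical_measure)
  have "tight M"
    unfolding M_def by (rule tight_empirical_measure[OF N1 mean_abs_le[OF N(1) c]])
  from tight_imp_convergent_subsubsequence[OF this strict_mono_id]
  obtain r \<mu> where r: "strict_mono r" and \<mu>: "real_distribution \<mu>" "weak_conv_m (M \<circ> r) \<mu>"
    by auto
  have Mr: "real_distribution ((M \<circ> r) k)" for k
    using M by simp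
  from Skorohod[OF Mr \<mu>] obtain \<Omega> :: "real measure" and X Z where
    \<Omega>: "prob_space \<Omega>" and X [measurable]: "\<And>k. X k \<in> borel_measurable \<Omega>"
      and distr_X: "\<And>k. distr \<Omega> borel (X k) = M (r k)"
      and Z: "Z \<in> measurable \<Omega> lborel" and distr_Z: "distr \<Omega> borel Z = \<mu>"
      and lim: "\<And>x. x \<in> space \<Omega> \<Longrightarrow> (\<lambda>k. X k x) \<longlonglongrightarrow> Z x"
    unfolding comp_def by blast
  interpret \<Omega>: prob_space \<Omega> by fact
  have Z' [measurable]: "Z \<in> borel_measurable \<Omega>"
    using Z by simp
  \<comment> \<open>The square of the sample space carries two independent copies of
    \<open>V\<close>, so pointwise limits pass to pairs.\<close>
  have prod: "distr \<Omega> borel V \<Otimes>\<^sub>M distr \<Omega> borel V = distr (\<Omega> \<Otimes>\<^sub>M \<Omega>) (borel \<Otimes>\<^sub>M borel) (\<lambda>(a, b). (V a, V b))"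
    if "V \<in> borel_measurable \<Omega>" for V :: "real \<Rightarrow> real"
    using that \<Omega>.prob_space_distr[OF that]
    by (intro pair_measure_distr) (auto simp: prob_space_imp_sigma_finite)
  let ?n = "\<lambda>k. N (r k)"
  let ?b = "\<lambda>n. c + B + (2 * c + 2 * B + ln (real n)) / real n"
  have n: "filterlim ?n at_top sequentially"
    using filterlim_compose[OF N(2) filterlim_subseq[OF r]] .
  have \<delta>: "(\<lambda>k. 1 / real (?n k)) \<longlonglongrightarrow> 0"
    using filterlim_compose[OF lim_1_over_n n] .
  have "?b \<longlonglongrightarrow> c + B + 0"
  proof (intro tendsto_add tendsto_const)
    have "(\<lambda>n. (2 * c + 2 * B) * (1 / real n) + ln (real n) / real n) \<longlonglongrightarrow> (2 * c + 2 * B) * 0 + 0"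
      by (intro tendsto_add tendsto_mult tendsto_const lim_1_over_n lim_ln_over_n)
    then show "(\<lambda>n. (2 * c + 2 * B + ln (real n)) / real n) \<longlonglongrightarrow> 0"
      by (simp add: add_divide_distrib)
  qed
  from filterlim_compose[OF this n] have b: "(\<lambda>k. ennreal (?b (?n k))) \<longlonglongrightarrow> ennreal (c + B)"
    by (intro tendsto_ennrealI) simp
  have "(\<integral>\<^sup>+ (x, y). kernel x y \<partial>(\<mu> \<Otimes>\<^sub>M \<mu>)) = (\<integral>\<^sup>+ p. kernel (Z (fst p)) (Z (snd p)) \<partial>(\<Omega> \<Otimes>\<^sub>M \<Omega>))"
    unfolding distr_Z[symmetric] prod[OF Z'] by (subst nn_integral_distr) (auto simp: case_prod_beta)
  also have "\<dots> \<le> (\<integral>\<^sup>+ p. liminf (\<lambda>k. ennreal (truncated_kernel (1 / ?n k) (X k (fst p)) (X k (snd p)))) \<partial>(\<Omega> \<Otimes>\<^sub>M \<Omega>))"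
  proof (rule nn_integral_mono)
    fix p assume "p \<in> space (\<Omega> \<Otimes>\<^sub>M \<Omega>)"
    then have "(\<lambda>k. ennreal (truncated_kernel (1 / ?n k) (X k (fst p)) (X k (snd p)))) \<longlonglongrightarrow> kernel (Z (fst p)) (Z (snd p))"
      using N1 by (intro truncated_kernel_tendsto lim \<delta>) (auto simp: space_pair_measure Suc_le_eq)
    then show "kernel (Z (fst p)) (Z (snd p))
        \<le> liminf (\<lambda>k. ennreal (truncated_kernel (1 / ?n k) (X k (fst p)) (X k (snd p))))"
      by (simp add: lim_imp_Liminf)
  qed
  also have "\<dots> \<le> liminf (\<lambda>k. \<integral>\<^sup>+ p. ennreal (truncated_kernel (1 / ?n k) (X k (fst p)) (X k (snd p))) \<partial>(\<Omega> \<Otimes>\<^sub>M \<Omega>))"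
    by (rule nn_integral_liminf) measurable
  also have "\<dots> \<le> liminf (\<lambda>k. ennreal (?b (?n k)))"
  proof (intro Liminf_mono always_eventually allI)
    fix k
    have "(\<integral>\<^sup>+ p. ennreal (truncated_kernel (1 / ?n k) (X k (fst p)) (X k (snd p))) \<partial>(\<Omega> \<Otimes>\<^sub>M \<Omega>))
        = (\<integral>\<^sup>+ (x, x'). ennreal (truncated_kernel (1 / ?n k) x x') \<partial>(M (r k) \<Otimes>\<^sub>M M (r k)))"
      unfolding distr_X[symmetric] prod[OF X] by (subst nn_integral_distr) (auto simp: case_prod_beta)
    also have "\<dots> \<le> ennreal (?b (?n k))"
      unfolding M_def by (intro nn_integral_truncated_kernel_empirical_le N inj c)
    finally show "(\<integral>\<^sup>+ p. ennreal (truncated_kernel (1 / ?n k) (X k (fst p)) (X k (snd p))) \<partial>(\<Omega> \<Otimes>\<^sub>M \<Omega>))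
        \<le> ennreal (?b (?n k))" .
  qed
  also have "\<dots> = ennreal (c + B)"
    using b by (intro lim_imp_Liminf) auto
  finally have K: "(\<integral>\<^sup>+ (x, y). kernel x y \<partial>(\<mu> \<Otimes>\<^sub>M \<mu>)) \<le> ennreal (c + B)" .
  \<comment> \<open>Gives \<open>0 \<le> c + B\<close>, so that \<open>ennreal (c + B)\<close> is
    not a truncation.\<close>
  have "0 \<le> (\<Sum>i=1..N 0. \<bar>y 0 i\<bar>) / N 0"
    by (simp add: sum_nonneg)
  also note mean_abs_le[OF N(1)[of 0] c[of 0]]
  finally have "0 \<le> c + B"
    by simp
  then have "energy Q \<mu> \<le> ereal c"
    using K unfolding energy_eq[OF \<mu>(1)]
    by (cases "\<integral>\<^sup>+ (x, y). kernel x y \<partial>(\<mu> \<Otimes>\<^sub>M \<mu>)") (auto simp: enn2ereal_ennreal top_unique)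
  with \<mu>(1) show ?thesis
    by (rule that)
qed

section \<open>Convergence of Fekete points\<close>

lemma config_energy_le_energy:
  assumes "2 \<le> n" "real_distribution \<nu>" "fekete_point Q n y" "energy Q \<nu> = ereal e"
  shows "config_energy Q n y \<le> e"
    and "W2 \<nu> (empirical_measure n y) \<le> ennreal (sqrt ((e - config_energy Q n y) / \<rho>))"
proof -
  have gap: "ereal \<rho> * (enn2ereal (W2 \<nu> (empirical_measure n y)))\<^sup>2 \<le> ereal (e - config_energy Q n y)"
    using energy_gap[OF assms(1-3)] fekete_pointD[OF assms(1,3)] assms(4) by simp
  \<comment> \<open>An infinite distance would make the left side of \<open>gap\<close> infinite, as
    \<rho> is positive.\<close>
  obtain w where w: "W2 \<nu> (empirical_measure n y) = ennreal w" "0 \<le> w"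
    using gap rho_pos by (cases "W2 \<nu> (empirical_measure n y)") auto
  then have "\<rho> * w\<^sup>2 \<le> e - config_energy Q n y"
    using gap by (simp add: enn2ereal_ennreal)
  moreover have "0 \<le> \<rho> * w\<^sup>2"
    using rho_pos by simp
  ultimately show "config_energy Q n y \<le> e"
    by linarith
  have "w\<^sup>2 \<le> (e - config_energy Q n y) / \<rho>"
    using \<open>\<rho> * w\<^sup>2 \<le> _\<close> rho_pos by (simp add: field_simps)
  then show "W2 \<nu> (empirical_measure n y) \<le> ennreal (sqrt ((e - config_energy Q n y) / \<rho>))"
    unfolding w(1) by (intro ennreal_leI real_le_rsqrt)
qed

lemma min_energy_finite:
  obtains e where "min_energy Q = ereal e"
proof -
  obtain \<nu> where \<nu>: "real_distribution \<nu>" "energy Q \<nu> < \<infinity>"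
    by (rule finite_energy_measure)
  have "min_energy Q \<le> energy Q \<nu>"
    unfolding min_energy_def using \<nu> by (intro INF_lower) simp
  moreover have "ereal (- B) \<le> min_energy Q"
    unfolding min_energy_def
  proof (rule INF_greatest)
    fix \<mu> :: "real measure" assume "\<mu> \<in> {\<mu>. real_distribution \<mu>}"
    then have "energy Q \<mu> = enn2ereal (\<integral>\<^sup>+ (x, y). kernel x y \<partial>(\<mu> \<Otimes>\<^sub>M \<mu>)) - ereal B"
      by (simp add: energy_eq)
    moreover have "ereal 0 - ereal B \<le> enn2ereal K - ereal B" for K
      by (intro ereal_minus_mono) (simp_all flip: zero_ereal_def)
    ultimately show "ereal (- B) \<le> energy Q \<mu>"
      by (metis ereal_minus(1) diff_0)
  qed
  ultimately show ?thesis
    using \<nu>(2) that by (cases "min_energy Q") auto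
qed

lemma config_energy_tendsto:
  assumes e: "min_energy Q = ereal e"
    and Y: "\<And>n. 2 \<le> n \<Longrightarrow> inj_on (Y n) {1..n}" "\<And>n. 2 \<le> n \<Longrightarrow> config_energy Q n (Y n) \<le> e"
  shows "(\<lambda>n. config_energy Q n (Y n)) \<longlonglongrightarrow> e"
proof (rule ccontr)
  assume "\<not> ?thesis"
  then obtain \<epsilon> where \<epsilon>: "0 < \<epsilon>" "\<not> (\<forall>\<^sub>F n in sequentially. dist (config_energy Q n (Y n)) e < \<epsilon>)"
    by (auto simp: tendsto_iff)
  \<comment> \<open>The energies never exceed \<open>e\<close>, so convergence can only fail from
    below, along an infinite set of indices.\<close>
  define S where "S = {n. 2 \<le> n \<and> config_energy Q n (Y n) \<le> e - \<epsilon>}"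
  have "infinite S"
  proof
    assume "finite S"
    then have "\<forall>\<^sub>F n in sequentially. n \<notin> S"
      by (simp add: eventually_cofinite flip: cofinite_eq_sequentially)
    then have "\<forall>\<^sub>F n in sequentially. dist (config_energy Q n (Y n)) e < \<epsilon>"
      using eventually_ge_at_top[of 2]
    proof eventually_elim
      case (elim n)
      then show ?case
        using Y(2)[of n] by (auto simp: S_def dist_real_def)
    qed
    with \<epsilon> show False by simp
  qed
  then obtain N :: "nat \<Rightarrow> nat" where N: "strict_mono N" "\<And>k. N k \<in> S"
    using infinite_enumerate by blast
  then obtain \<mu> where "real_distribution \<mu>" "energy Q \<mu> \<le> ereal (e - \<epsilon>)"
    using limit_energy[of N "\<lambda>k. Y (N k)" "e - \<epsilon>"] Y(1) filterlim_subseq[OF N(1)] by (auto simp: S_def)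
  moreover have "min_energy Q \<le> energy Q \<mu>"
    unfolding min_energy_def using \<open>real_distribution \<mu>\<close> by (intro INF_lower) simp
  ultimately have "ereal e \<le> ereal (e - \<epsilon>)"
    unfolding e by (meson order_trans)
  with \<epsilon>(1) show False by simp
qed

lemma fekete_convergence:
  assumes \<mu>: "minimizing_measure Q \<mu>" and Y: "\<forall>n\<ge>2. fekete_point Q n (Y n)"
  shows "min_discrete_energy Q \<longlonglongrightarrow> min_energy Q"
    and "(\<lambda>n. W2 \<mu> (empirical_measure n (Y n))) \<longlonglongrightarrow> 0"
    and "weak_conv_m (\<lambda>n. empirical_measure n (Y n)) \<mu>"
proof -
  obtain e where e: "min_energy Q = ereal e"
    by (rule min_energy_finite)
  have \<mu>': "real_distribution \<mu>" "energy Q \<mu> = ereal e"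
    using \<mu> e by (simp_all add: minimizing_measure_def)
  have le: "config_energy Q n (Y n) \<le> e"
      "W2 \<mu> (empirical_measure n (Y n)) \<le> ennreal (sqrt ((e - config_energy Q n (Y n)) / \<rho>))" if "2 \<le> n" for n
    using config_energy_le_energy[OF that \<mu>'(1) _ \<mu>'(2)] that Y by auto
  have lim: "(\<lambda>n. config_energy Q n (Y n)) \<longlonglongrightarrow> e"
    using fekete_pointD(1) Y le(1) by (intro config_energy_tendsto e) auto
  have "\<forall>\<^sub>F n in sequentially. ereal (config_energy Q n (Y n)) = min_discrete_energy Q n"
    using eventually_ge_at_top[of 2] by eventually_elim (use fekete_pointD(2) Y in auto)
  moreover have "(\<lambda>n. ereal (config_energy Q n (Y n))) \<longlonglongrightarrow> min_energy Q"
    using lim by (simp add: e)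
  ultimately show "min_discrete_energy Q \<longlonglongrightarrow> min_energy Q"
    by (rule Lim_transform_eventually[rotated])
  have "(\<lambda>n. ennreal (sqrt ((e - config_energy Q n (Y n)) / \<rho>))) \<longlonglongrightarrow> ennreal (sqrt ((e - e) / \<rho>))"
    using rho_pos by (intro tendsto_intros lim) auto
  then have sqrt: "(\<lambda>n. ennreal (sqrt ((e - config_energy Q n (Y n)) / \<rho>))) \<longlonglongrightarrow> 0"
    by simp
  have "\<forall>\<^sub>F n in sequentially. W2 \<mu> (empirical_measure n (Y n)) \<le> ennreal (sqrt ((e - config_energy Q n (Y n)) / \<rho>))"
    using eventually_ge_at_top[of 2] by eventually_elim (rule le(2))
  from tendsto_sandwich[OF _ this tendsto_const sqrt]
  show W2: "(\<lambda>n. W2 \<mu> (empirical_measure n (Y n))) \<longlonglongrightarrow> 0"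
    by simp
  let ?M = "\<lambda>n. empirical_measure n (Y n)"
  \<comment> \<open>At \<open>n = 0\<close> the empirical measure is the zero measure, so the
    sequence is shifted by one to consist of probability measures.\<close>
  have Suc: "real_distribution (?M (Suc n))" for n
    by (intro real_distribution_empirical_measure) simp
  have "weak_conv_m (\<lambda>n. ?M (Suc n)) \<mu>"
    using LIMSEQ_Suc[OF W2] by (rule weak_conv_of_W2[OF \<mu>'(1) Suc])
  then show "weak_conv_m ?M \<mu>"
    unfolding weak_conv_m_def weak_conv_def by (auto intro: LIMSEQ_imp_Suc)
qed

end

theorem proposition2p20:
  fixes \<rho> :: real and Q :: "real \<Rightarrow> real"
  assumes "\<rho> > 0"
    and "convex_on UNIV (\<lambda>x. Q x - \<rho> * x\<^sup>2)"
  shows "(\<forall>n \<nu> y. 2 \<le> n \<longrightarrow> real_distribution \<nu> \<longrightarrow> fekete_point Q n y \<longrightarrow>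
            ereal \<rho> * (enn2ereal (W2 \<nu> (empirical_measure n y)))\<^sup>2
              \<le> energy Q \<nu> - min_discrete_energy Q n)
       \<and> (\<forall>\<mu>\<^sub>Q Y. minimizing_measure Q \<mu>\<^sub>Q \<longrightarrow> (\<forall>n\<ge>2. fekete_point Q n (Y n)) \<longrightarrow>
            min_discrete_energy Q \<longlonglongrightarrow> min_energy Q
          \<and> (\<lambda>n. W2 \<mu>\<^sub>Q (empirical_measure n (Y n))) \<longlonglongrightarrow> 0
          \<and> weak_conv_m (\<lambda>n. empirical_measure n (Y n)) \<mu>\<^sub>Q)"
proof -
  obtain B where "0 \<le> B" "\<And>x. 4 * \<bar>x\<bar> - B \<le> Q x"
    using strongly_convex_coercive[OF assms] by blast
  with assms interpret external_field Q \<rho> B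
    unfolding external_field_def by blast
  show ?thesis
    using energy_gap fekete_convergence by blast
qed

end
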